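(* Let $\overline{M}=I\times_{f}L$ be a Generalized-Robertson-Walker space, let $h$ be a primitive of $-f$, viewed as a function on $\overline{M}$ by $(t,x)\mapsto h(t)$, and let $M$ be a null hypersurface of $\overline{M}$, with inclusion $i:M\hookrightarrow\overline{M}$, equipped with the rigging $\zeta=f\frac{\partial}{\partial t}$, such that $h\circ i$ is a proper function on $M$. Then the rigged Riemannian structure $(M,\widetilde{g})$ is complete.
   Context: A Generalized-Robertson-Walker space $I\times_fL$ is the product of an open interval $I\subset\mathbb{R}$ and a Riemannian manifold $(L,g_0)$ with Lorentzian metric $\overline{g}=-dt^{2}+f(t)^{2}g_{0}$, where $f:I\to(0,\infty)$ is smooth. A null hypersurface $M$ is a smooth codimension-one submanifold such that the restriction of $\overline{g}$ to each $T_pM$ is degenerate. A rigging for $M$ is a vector field $\zeta$ on an open set containing $M$ with $\zeta_p\notin T_pM$ for each $p\in M$. With $\alpha=\overline{g}(\zeta,\cdot)$, the rigged Riemannian structure on $M$ is $\widetilde{g}=i^{\star}(\overline{g}+\alpha\otimes\alpha)$, which is a Riemannian metric. *)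

theory Defs
  imports "HOL-Analysis.Analysis"
begin

section \<open>Smooth maps between Euclidean spaces\<close>

text \<open>\<^term>\<open>S\<close> is meant to be open throughout.\<close>

primrec C_on :: "nat \<Rightarrow> 'a::real_normed_vector set \<Rightarrow> ('a \<Rightarrow> 'b::real_normed_vector) \<Rightarrow> bool" where
  "C_on 0 S F \<longleftrightarrow> continuous_on S F"
| "C_on (Suc k) S F \<longleftrightarrow> (\<forall>x\<in>S. F differentiable (at x)) \<and>
     (\<forall>v. C_on k S (\<lambda>x. frechet_derivative F (at x) v))"

definition smooth_on :: "'a::real_normed_vector set \<Rightarrow> ('a \<Rightarrow> 'b::real_normed_vector) \<Rightarrow> bool" where
  "smooth_on S F \<longleftrightarrow> (\<forall>k. C_on k S F)"


section \<open>Smooth manifolds\<close>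

text \<open>A chart is a pair of its domain and its coordinate map. The atlas is not required to be
  maximal: an atlas determines the smooth structure, and none of the notions below depends on which
  atlas of that structure is used.\<close>

type_synonym ('a, 'e) chart = "'a set \<times> ('a \<Rightarrow> 'e)"

record ('a, 'e) manifold =
  mtop :: "'a topology"
  atlas :: "('a, 'e) chart set"

abbreviation points :: "('a, 'e) manifold \<Rightarrow> 'a set" where
  "points M \<equiv> topspace (mtop M)"

definition chart_inv :: "('a, 'e) chart \<Rightarrow> 'e \<Rightarrow> 'a" where
  "chart_inv c = inv_into (fst c) (snd c)"

definition charts_at :: "('a, 'e) manifold \<Rightarrow> 'a \<Rightarrow> ('a, 'e) chart set" where
  "charts_at M p = {c \<in> atlas M. p \<in> fst c}"

definition smooth_manifold :: "('a, 'e::euclidean_space) manifold \<Rightarrow> bool" where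
  "smooth_manifold M \<longleftrightarrow>
     Hausdorff_space (mtop M) \<and> second_countable (mtop M) \<and>
     (\<Union>c\<in>atlas M. fst c) = points M \<and>
     (\<forall>c\<in>atlas M. openin (mtop M) (fst c) \<and> open (snd c ` fst c) \<and>
        homeomorphic_map (subtopology (mtop M) (fst c)) (top_of_set (snd c ` fst c)) (snd c)) \<and>
     (\<forall>c\<in>atlas M. \<forall>d\<in>atlas M. smooth_on (snd c ` (fst c \<inter> fst d)) (snd d \<circ> chart_inv c))"

definition smooth_map ::
  "('a, 'e::euclidean_space) manifold \<Rightarrow> ('b, 'k::euclidean_space) manifold \<Rightarrow> ('a \<Rightarrow> 'b) \<Rightarrow> bool" where
  "smooth_map M N F \<longleftrightarrow> continuous_map (mtop M) (mtop N) F \<and>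
     (\<forall>c\<in>atlas M. \<forall>d\<in>atlas N.
        smooth_on (snd c ` (fst c \<inter> F -` fst d)) (snd d \<circ> F \<circ> chart_inv c))"

definition interval_manifold :: "real set \<Rightarrow> (real, real) manifold" where
  "interval_manifold I = \<lparr>mtop = top_of_set I, atlas = {(I, id)}\<rparr>"

definition product_manifold ::
  "('a, 'e) manifold \<Rightarrow> ('b, 'k) manifold \<Rightarrow> ('a \<times> 'b, 'e \<times> 'k) manifold" where
  "product_manifold M N =
     \<lparr>mtop = prod_topology (mtop M) (mtop N),
      atlas = {(fst c \<times> fst d, map_prod (snd c) (snd d)) |c d. c \<in> atlas M \<and> d \<in> atlas N}\<rparr>"


section \<open>Tangent vectors\<close>

text \<open>A tangent vector at \<^term>\<open>p\<close> is the family of its coordinate vectors in all charts around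
  \<^term>\<open>p\<close>, these being related by the derivatives of the coordinate changes; its value at all other
  arguments is fixed to be 0. The vector space operations are pointwise.\<close>

type_synonym ('a, 'e) tvec = "('a, 'e) chart \<Rightarrow> 'e"

definition coord_vec ::
  "('a, 'e::euclidean_space) manifold \<Rightarrow> ('a, 'e) chart \<Rightarrow> 'a \<Rightarrow> 'e \<Rightarrow> ('a, 'e) tvec" where
  "coord_vec M c p x = (\<lambda>d. if d \<in> charts_at M p
     then frechet_derivative (snd d \<circ> chart_inv c) (at (snd c p)) x else 0)"

definition tangent_space ::
  "('a, 'e::euclidean_space) manifold \<Rightarrow> 'a \<Rightarrow> ('a, 'e) tvec set" where
  "tangent_space M p = {v. \<forall>c\<in>charts_at M p. v = coord_vec M c p (v c)}"

text \<open>The differential at \<^term>\<open>p\<close> of a map into a normed space; the choice of the chart is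
  immaterial for a smooth map and a tangent vector.\<close>

definition dfun ::
  "('a, 'e::euclidean_space) manifold \<Rightarrow> ('a \<Rightarrow> 'b::real_normed_vector) \<Rightarrow> 'a \<Rightarrow> ('a, 'e) tvec \<Rightarrow> 'b" where
  "dfun M F p v = (let c = (SOME c. c \<in> charts_at M p)
     in frechet_derivative (F \<circ> chart_inv c) (at (snd c p)) (v c))"

definition differential ::
  "('a, 'e::euclidean_space) manifold \<Rightarrow> ('b, 'k::euclidean_space) manifold \<Rightarrow> ('a \<Rightarrow> 'b) \<Rightarrow>
     'a \<Rightarrow> ('a, 'e) tvec \<Rightarrow> ('b, 'k) tvec" where
  "differential M N F p v = (\<lambda>d. if d \<in> charts_at N (F p) then dfun M (snd d \<circ> F) p v else 0)"

definition velocity ::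
  "('a, 'e::euclidean_space) manifold \<Rightarrow> (real \<Rightarrow> 'a) \<Rightarrow> real \<Rightarrow> ('a, 'e) tvec" where
  "velocity M \<gamma> t = (\<lambda>c. if c \<in> charts_at M (\<gamma> t)
     then vector_derivative (snd c \<circ> \<gamma>) (at t) else 0)"

definition smooth_vector_field ::
  "('a, 'e::euclidean_space) manifold \<Rightarrow> 'a set \<Rightarrow> ('a \<Rightarrow> ('a, 'e) tvec) \<Rightarrow> bool" where
  "smooth_vector_field M U \<zeta> \<longleftrightarrow> (\<forall>p\<in>U. \<zeta> p \<in> tangent_space M p) \<and>
     (\<forall>c\<in>atlas M. smooth_on (snd c ` (fst c \<inter> U)) (\<lambda>x. \<zeta> (chart_inv c x) c))"


section \<open>Riemannian metrics, distance and completeness\<close>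

type_synonym ('a, 'e) tensor2 = "'a \<Rightarrow> ('a, 'e) tvec \<Rightarrow> ('a, 'e) tvec \<Rightarrow> real"

definition pullback ::
  "('a, 'e::euclidean_space) manifold \<Rightarrow> ('b, 'k::euclidean_space) manifold \<Rightarrow> ('a \<Rightarrow> 'b) \<Rightarrow>
     ('b, 'k) tensor2 \<Rightarrow> ('a, 'e) tensor2" where
  "pullback M N F T =
     (\<lambda>p u v. T (F p) (differential M N F p u) (differential M N F p v))"

text \<open>Linearity in the second argument follows from symmetry.\<close>

definition riemannian_metric ::
  "('a, 'e::euclidean_space) manifold \<Rightarrow> ('a, 'e) tensor2 \<Rightarrow> bool" where
  "riemannian_metric M g \<longleftrightarrow>
     (\<forall>p\<in>points M. \<forall>u\<in>tangent_space M p. \<forall>v\<in>tangent_space M p.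
        g p u v = g p v u \<and>
        (\<forall>w\<in>tangent_space M p. \<forall>a b.
           g p (\<lambda>c. a *\<^sub>R u c + b *\<^sub>R v c) w = a * g p u w + b * g p v w) \<and>
        (u \<noteq> (\<lambda>_. 0) \<longrightarrow> g p u u > 0)) \<and>
     (\<forall>c\<in>atlas M. \<forall>x y. smooth_on (snd c ` fst c)
        (\<lambda>z. let p = chart_inv c z in g p (coord_vec M c p x) (coord_vec M c p y)))"

definition C1_curve_on ::
  "('a, 'e::euclidean_space) manifold \<Rightarrow> (real \<Rightarrow> 'a) \<Rightarrow> real \<Rightarrow> real \<Rightarrow> bool" where
  "C1_curve_on M \<gamma> a b \<longleftrightarrow> continuous_map (top_of_set {a..b}) (mtop M) \<gamma> \<and>
     (\<forall>c\<in>atlas M. \<exists>D. continuous_on {t\<in>{a..b}. \<gamma> t \<in> fst c} D \<and>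
        (\<forall>t\<in>{a..b}. \<gamma> t \<in> fst c \<longrightarrow>
           ((snd c \<circ> \<gamma>) has_vector_derivative D t) (at t within {a..b})))"

definition piecewise_C1_curve_on ::
  "('a, 'e::euclidean_space) manifold \<Rightarrow> (real \<Rightarrow> 'a) \<Rightarrow> real \<Rightarrow> real \<Rightarrow> bool" where
  "piecewise_C1_curve_on M \<gamma> a b \<longleftrightarrow> a < b \<and>
     (\<exists>n (s :: nat \<Rightarrow> real). s 0 = a \<and> s n = b \<and>
        (\<forall>k<n. s k < s (Suc k) \<and> C1_curve_on M \<gamma> (s k) (s (Suc k))))"

text \<open>The velocity of a piecewise C1 curve may be undefined at finitely many parameters, which do
  not contribute to the integral.\<close>

definition curve_length ::
  "('a, 'e::euclidean_space) manifold \<Rightarrow> ('a, 'e) tensor2 \<Rightarrow> (real \<Rightarrow> 'a) \<Rightarrow> real \<Rightarrow> real \<Rightarrow> real" where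
  "curve_length M g \<gamma> a b =
     integral {a..b} (\<lambda>t. sqrt (g (\<gamma> t) (velocity M \<gamma> t) (velocity M \<gamma> t)))"

text \<open>Manifolds need not be connected; the distance between points that are not joined by any
  curve is infinite.\<close>

definition riemannian_dist ::
  "('a, 'e::euclidean_space) manifold \<Rightarrow> ('a, 'e) tensor2 \<Rightarrow> 'a \<Rightarrow> 'a \<Rightarrow> ereal" where
  "riemannian_dist M g p q = Inf {ereal (curve_length M g \<gamma> a b) |\<gamma> a b.
     piecewise_C1_curve_on M \<gamma> a b \<and> \<gamma> a = p \<and> \<gamma> b = q}"

definition riemannian_complete ::
  "('a, 'e::euclidean_space) manifold \<Rightarrow> ('a, 'e) tensor2 \<Rightarrow> bool" where
  "riemannian_complete M g \<longleftrightarrow>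
     (\<forall>\<sigma> :: nat \<Rightarrow> 'a. range \<sigma> \<subseteq> points M \<and>
        (\<forall>e>0. \<exists>N. \<forall>m\<ge>N. \<forall>n\<ge>N. riemannian_dist M g (\<sigma> m) (\<sigma> n) < ereal e) \<longrightarrow>
        (\<exists>p\<in>points M. (\<lambda>n. riemannian_dist M g (\<sigma> n) p) \<longlonglongrightarrow> 0))"


section \<open>Generalized Robertson-Walker spaces\<close>

definition grw_manifold ::
  "real set \<Rightarrow> ('a, 'e) manifold \<Rightarrow> (real \<times> 'a, real \<times> 'e) manifold" where
  "grw_manifold I L = product_manifold (interval_manifold I) L"

definition grw_metric ::
  "real set \<Rightarrow> (real \<Rightarrow> real) \<Rightarrow> ('a, 'e::euclidean_space) manifold \<Rightarrow> ('a, 'e) tensor2 \<Rightarrow>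
     (real \<times> 'a, real \<times> 'e) tensor2" where
  "grw_metric I f L g0 = (\<lambda>p u v.
     - (dfun (grw_manifold I L) fst p u * dfun (grw_manifold I L) fst p v)
     + (f (fst p))\<^sup>2 * pullback (grw_manifold I L) L snd g0 p u v)"

text \<open>The coordinate field of the first factor, as the velocity of the curves
  \<open>s \<mapsto> (s, x)\<close>.\<close>

definition grw_dt ::
  "real set \<Rightarrow> ('a, 'e::euclidean_space) manifold \<Rightarrow> real \<times> 'a \<Rightarrow> (real \<times> 'a, real \<times> 'e) tvec" where
  "grw_dt I L p = velocity (grw_manifold I L) (\<lambda>s. (s, snd p)) (fst p)"


section \<open>Null hypersurfaces and riggings\<close>

text \<open>A submanifold is a subset with a manifold structure of its own for which the inclusion is an
  immersion. The topology need not be the subspace topology, so that both embedded and injectively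
  immersed hypersurfaces are covered.\<close>

definition submanifold ::
  "('a, 'm::euclidean_space) manifold \<Rightarrow> ('a, 'k::euclidean_space) manifold \<Rightarrow> bool" where
  "submanifold M N \<longleftrightarrow> smooth_manifold M \<and> points M \<subseteq> points N \<and> smooth_map M N id \<and>
     (\<forall>p\<in>points M. inj_on (differential M N id p) (tangent_space M p))"

definition hypersurface ::
  "('a, 'm::euclidean_space) manifold \<Rightarrow> ('a, 'k::euclidean_space) manifold \<Rightarrow> bool" where
  "hypersurface M N \<longleftrightarrow> submanifold M N \<and> DIM('m) + 1 = DIM('k)"

definition null_hypersurface ::
  "('a, 'm::euclidean_space) manifold \<Rightarrow> ('a, 'k::euclidean_space) manifold \<Rightarrow> ('a, 'k) tensor2 \<Rightarrow> bool" where
  "null_hypersurface M N g \<longleftrightarrow> hypersurface M N \<and>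
     (\<forall>p\<in>points M. \<exists>u\<in>tangent_space M p. u \<noteq> (\<lambda>_. 0) \<and>
        (\<forall>v\<in>tangent_space M p. pullback M N id g p u v = 0))"

definition rigging ::
  "('a, 'm::euclidean_space) manifold \<Rightarrow> ('a, 'k::euclidean_space) manifold \<Rightarrow>
     ('a \<Rightarrow> ('a, 'k) tvec) \<Rightarrow> bool" where
  "rigging M N \<zeta> \<longleftrightarrow>
     (\<exists>U. openin (mtop N) U \<and> points M \<subseteq> U \<and> smooth_vector_field N U \<zeta>) \<and>
     (\<forall>p\<in>points M. \<zeta> p \<notin> differential M N id p ` tangent_space M p)"

definition rigged_metric ::
  "('a, 'm::euclidean_space) manifold \<Rightarrow> ('a, 'k::euclidean_space) manifold \<Rightarrow> ('a, 'k) tensor2 \<Rightarrow>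
     ('a \<Rightarrow> ('a, 'k) tvec) \<Rightarrow> ('a, 'm) tensor2" where
  "rigged_metric M N g \<zeta> =
     pullback M N id (\<lambda>p u v. g p u v + g p (\<zeta> p) u * g p (\<zeta> p) v)"

end

theory Submission
  imports Defs
begin

text \<open>Write \<open>dt\<close> for the differential of the time coordinate. For the rigging \<open>\<zeta> = f \<partial>\<^sub>t\<close> the one-form
  \<open>\<alpha> = g(\<zeta>, \<cdot>)\<close> equals \<open>- f dt\<close>, which is the differential of \<open>\<phi>(t, x) = h(t)\<close>. Hence the rigged
  metric is \<open>g(v, v) + d\<phi>(v)\<^sup>2\<close> on tangent vectors of \<open>M\<close>. The Lorentzian metric restricted to a null
  hypersurface is positive semidefinite, by Cauchy-Schwarz on the fibre
  (\<open>null_hypersurface_time_le_space\<close>), so \<open>d\<phi>(v)\<^sup>2\<close> is at most the rigged square of \<open>v\<close>.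

  Thus \<open>\<phi>\<close> is 1-Lipschitz for the rigged distance (\<open>increment_le_riemannian_dist\<close>). A manifold with
  a proper 1-Lipschitz function is complete (\<open>riemannian_complete_if_proper\<close>): on a Cauchy sequence
  the function is bounded, so by properness the sequence has a cluster point in the manifold topology.
  Since that topology is finer than the one of the distance (\<open>riemannian_dist_small_nbhd\<close>), the
  triangle inequality turns the cluster point into the limit.

  The criterion is proved for an arbitrary form \<open>g\<close> whose quadratic form is jointly continuous in
  charts; nonnegativity of the distance comes from the Lipschitz bound itself. The continuity for the
  rigged metric follows from its expression through \<open>f\<close>, the metric of the fibre and the derivative
  of the inclusion (\<open>continuous_energy_rigged_metric\<close>).\<close>


section \<open>Charts and tangent vectors\<close>

lemma smooth_on_continuous_on: "smooth_on S F \<Longrightarrow> continuous_on S F"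
  unfolding smooth_on_def by (drule spec[of _ 0]) simp

lemma smooth_on_differentiable: "smooth_on S F \<Longrightarrow> x \<in> S \<Longrightarrow> F differentiable (at x)"
  unfolding smooth_on_def by (drule spec[of _ "Suc 0"]) simp

lemma smooth_on_derivative_continuous_on:
  "smooth_on S F \<Longrightarrow> continuous_on S (\<lambda>x. frechet_derivative F (at x) v)"
  unfolding smooth_on_def by (drule spec[of _ "Suc 0"]) simp

lemma charts_atD: "c \<in> charts_at M p \<Longrightarrow> c \<in> atlas M" "c \<in> charts_at M p \<Longrightarrow> p \<in> fst c"
  by (auto simp: charts_at_def)

lemma chart_inv_in: "z \<in> snd c ` fst c \<Longrightarrow> chart_inv c z \<in> fst c"
  unfolding chart_inv_def by (rule inv_into_into)

lemma chart_chart_inv: "z \<in> snd c ` fst c \<Longrightarrow> snd c (chart_inv c z) = z"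
  unfolding chart_inv_def by (rule f_inv_into_f)

text \<open>The atlas need not be maximal, so the differentiability of a map is tested in the charts of
  the atlas only; the lemmas below move statements between these charts by the chain rule.\<close>
context
  fixes M :: "('a, 'e::euclidean_space) manifold"
  assumes M: "smooth_manifold M"
begin

lemma
  assumes "c \<in> atlas M"
  shows openin_chart_domain: "openin (mtop M) (fst c)"
    and open_chart_image: "open (snd c ` fst c)"
    and chart_homeomorphic_map:
      "homeomorphic_map (subtopology (mtop M) (fst c)) (top_of_set (snd c ` fst c)) (snd c)"
  using M assms unfolding smooth_manifold_def by auto

lemma chart_domain_subset: "c \<in> atlas M \<Longrightarrow> fst c \<subseteq> points M"
  by (simp add: openin_chart_domain openin_subset)

lemma inj_on_chart: "c \<in> atlas M \<Longrightarrow> inj_on (snd c) (fst c)"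
  using homeomorphic_imp_injective_map[OF chart_homeomorphic_map, of c] chart_domain_subset[of c]
  by (simp add: inf.absorb2)

lemma chart_inv_chart: "c \<in> atlas M \<Longrightarrow> p \<in> fst c \<Longrightarrow> chart_inv c (snd c p) = p"
  unfolding chart_inv_def by (rule inv_into_f_f[OF inj_on_chart])

lemma ex_chart: "p \<in> points M \<Longrightarrow> \<exists>c. c \<in> charts_at M p"
  using M unfolding smooth_manifold_def charts_at_def by blast

lemma open_chart_image_Int:
  assumes c: "c \<in> atlas M" and U: "openin (mtop M) U"
  shows "open (snd c ` (fst c \<inter> U))"
proof -
  have "openin (subtopology (mtop M) (fst c)) (fst c \<inter> U)"
    using U by (auto simp: openin_subtopology)
  then have "openin (top_of_set (snd c ` fst c)) (snd c ` (fst c \<inter> U))"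
    using homeomorphic_imp_open_map[OF chart_homeomorphic_map[OF c]] by (auto simp: open_map_def)
  then show ?thesis
    by (simp add: openin_open_eq[OF open_chart_image[OF c]])
qed

lemma continuous_map_chart:
  "c \<in> atlas M \<Longrightarrow> continuous_map (subtopology (mtop M) (fst c)) euclidean (snd c)"
  using homeomorphic_imp_continuous_map[OF chart_homeomorphic_map, of c]
  by (simp add: continuous_map_in_subtopology)

lemma continuous_map_chart_inv:
  assumes c: "c \<in> atlas M"
  shows "continuous_map (top_of_set (snd c ` fst c)) (mtop M) (chart_inv c)"
  unfolding continuous_map_def
proof (intro conjI allI impI)
  show "chart_inv c \<in> topspace (top_of_set (snd c ` fst c)) \<rightarrow> points M"
    using chart_inv_in[of _ c] chart_domain_subset[OF c] by auto
  fix U assume U: "openin (mtop M) U"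
  have "{z \<in> snd c ` fst c. chart_inv c z \<in> U} = snd c ` (fst c \<inter> U)"
    using chart_inv_chart[OF c] by auto
  then show "openin (top_of_set (snd c ` fst c))
      {z \<in> topspace (top_of_set (snd c ` fst c)). chart_inv c z \<in> U}"
    using open_chart_image_Int[OF c U] by (auto intro!: open_subset)
qed

lemma transition_differentiable:
  assumes "c \<in> charts_at M p" "d \<in> charts_at M p"
  shows "(snd d \<circ> chart_inv c) differentiable (at (snd c p))"
proof -
  have "smooth_on (snd c ` (fst c \<inter> fst d)) (snd d \<circ> chart_inv c)"
    using M assms by (simp add: smooth_manifold_def charts_at_def)
  then show ?thesis
    by (rule smooth_on_differentiable) (use assms in \<open>auto simp: charts_at_def\<close>)
qed

lemma has_derivative_change_chart:
  assumes c: "c \<in> charts_at M p" and d: "d \<in> charts_at M p"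
    and F: "((F \<circ> chart_inv d) has_derivative F') (at (snd d p))"
  shows "((F \<circ> chart_inv c) has_derivative
     (\<lambda>x. F' (frechet_derivative (snd d \<circ> chart_inv c) (at (snd c p)) x))) (at (snd c p))"
proof -
  note cd = charts_atD[OF c] charts_atD[OF d]
  let ?S = "snd c ` (fst c \<inter> fst d)"
  have T: "((snd d \<circ> chart_inv c) has_derivative
      frechet_derivative (snd d \<circ> chart_inv c) (at (snd c p))) (at (snd c p))"
    by (rule iffD1[OF frechet_derivative_works transition_differentiable[OF c d]])
  have "(((F \<circ> chart_inv d) \<circ> (snd d \<circ> chart_inv c)) has_derivative
      F' \<circ> frechet_derivative (snd d \<circ> chart_inv c) (at (snd c p))) (at (snd c p))"
    by (rule diff_chain_at[OF T]) (use F chart_inv_chart[OF cd(1,2)] in simp)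
  moreover have "open ?S"
    by (rule open_chart_image_Int[OF cd(1) openin_chart_domain[OF cd(3)]])
  ultimately have "((F \<circ> chart_inv c) has_derivative
      F' \<circ> frechet_derivative (snd d \<circ> chart_inv c) (at (snd c p))) (at (snd c p))"
    by (rule has_derivative_transform_within_open)
      (use cd chart_inv_chart[OF cd(1)] chart_inv_chart[OF cd(3)] in auto)
  then show ?thesis by (simp add: o_def)
qed

lemma dfun_eq:
  assumes c: "c \<in> charts_at M p" and v: "v \<in> tangent_space M p"
    and F: "\<And>d. d \<in> charts_at M p \<Longrightarrow> (F \<circ> chart_inv d) differentiable (at (snd d p))"
  shows "dfun M F p v = frechet_derivative (F \<circ> chart_inv c) (at (snd c p)) (v c)"
proof -
  define d where "d = (SOME d. d \<in> charts_at M p)"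
  have d: "d \<in> charts_at M p" unfolding d_def using c by (rule someI)
  have "v d = coord_vec M c p (v c) d"
    using v c by (auto simp: tangent_space_def dest: fun_cong)
  then have vd: "v d = frechet_derivative (snd d \<circ> chart_inv c) (at (snd c p)) (v c)"
    using d by (simp add: coord_vec_def)
  have "((F \<circ> chart_inv c) has_derivative
     (\<lambda>x. frechet_derivative (F \<circ> chart_inv d) (at (snd d p))
        (frechet_derivative (snd d \<circ> chart_inv c) (at (snd c p)) x))) (at (snd c p))"
    by (rule has_derivative_change_chart[OF c d]) (rule iffD1[OF frechet_derivative_works F[OF d]])
  from frechet_derivative_at[OF this]
  have "frechet_derivative (F \<circ> chart_inv c) (at (snd c p)) (v c) =
     frechet_derivative (F \<circ> chart_inv d) (at (snd d p)) (v d)"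
    unfolding vd by (rule fun_cong[OF sym])
  then show ?thesis by (simp add: dfun_def Let_def d_def)
qed

lemma coord_vec_same:
  assumes c: "c \<in> charts_at M p"
  shows "coord_vec M c p x c = x"
proof -
  note cc = charts_atD[OF c]
  have "((snd c \<circ> chart_inv c) has_derivative (\<lambda>x. x)) (at (snd c p))"
    by (rule has_derivative_transform_within_open[OF has_derivative_ident open_chart_image[OF cc(1)]])
      (use cc chart_inv_chart[OF cc(1)] in auto)
  from frechet_derivative_at[OF this, symmetric] show ?thesis
    using c by (simp add: coord_vec_def)
qed

lemma coord_vec_in_tangent_space:
  assumes c: "c \<in> charts_at M p"
  shows "coord_vec M c p x \<in> tangent_space M p"
  unfolding tangent_space_def mem_Collect_eq
proof (intro ballI ext)
  fix d e assume d: "d \<in> charts_at M p"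
  show "coord_vec M c p x e = coord_vec M d p (coord_vec M c p x d) e"
  proof (cases "e \<in> charts_at M p")
    case e: True
    have "((snd e \<circ> chart_inv c) has_derivative
     (\<lambda>x. frechet_derivative (snd e \<circ> chart_inv d) (at (snd d p))
        (frechet_derivative (snd d \<circ> chart_inv c) (at (snd c p)) x))) (at (snd c p))"
      by (rule has_derivative_change_chart[OF c d])
        (rule iffD1[OF frechet_derivative_works transition_differentiable[OF d e]])
    from fun_cong[OF frechet_derivative_at[OF this], of x] show ?thesis
      using d e by (simp add: coord_vec_def)
  qed (simp add: coord_vec_def)
qed

lemma coord_vec_tangent:
  assumes "v \<in> tangent_space M p" "c \<in> charts_at M p"
  shows "coord_vec M c p (v c) = v"
  using assms unfolding tangent_space_def by auto

lemma linear_transition: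
  assumes "c \<in> charts_at M p" "d \<in> charts_at M p"
  shows "linear (frechet_derivative (snd d \<circ> chart_inv c) (at (snd c p)))"
  using transition_differentiable[OF assms] by (rule linear_frechet_derivative)

lemma coord_vec_linear:
  assumes c: "c \<in> charts_at M p"
  shows "coord_vec M c p (a *\<^sub>R x + b *\<^sub>R y) = (\<lambda>d. a *\<^sub>R coord_vec M c p x d + b *\<^sub>R coord_vec M c p y d)"
  using linear_transition[OF c]
  by (auto simp: coord_vec_def linear_iff)

lemma coord_vec_zero:
  assumes c: "c \<in> charts_at M p"
  shows "coord_vec M c p 0 = (\<lambda>_. 0)"
  using coord_vec_linear[OF c, of 0 0 0 0] by simp

lemma zero_in_tangent_space:
  assumes "p \<in> points M" shows "(\<lambda>_. 0) \<in> tangent_space M p"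
proof -
  obtain c where c: "c \<in> charts_at M p" using ex_chart[OF assms] ..
  show ?thesis using coord_vec_in_tangent_space[OF c, of 0] by (simp add: coord_vec_zero[OF c])
qed

end


section \<open>Speed and length of curves\<close>

text \<open>The quadratic form \<open>v \<mapsto> g(v, v)\<close> in the coordinates of a chart, as a function of the
  coordinates \<^term>\<open>z\<close> of the base point and of the coordinates \<^term>\<open>x\<close> of the vector.\<close>
definition chart_energy ::
  "('a, 'e::euclidean_space) manifold \<Rightarrow> ('a, 'e) tensor2 \<Rightarrow> ('a, 'e) chart \<Rightarrow> 'e \<Rightarrow> 'e \<Rightarrow> real" where
  "chart_energy M g c z x =
     (let p = chart_inv c z; v = coord_vec M c p x in g p v v)"

text \<open>The regularity that the arguments about lengths use. Neither bilinearity nor positivity of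
  the form is included: joint continuity makes speeds of C1 curves integrable, and vanishing at the
  zero vector makes short coordinate segments short for \<^term>\<open>g\<close>.\<close>
definition continuous_energy ::
  "('a, 'e::euclidean_space) manifold \<Rightarrow> ('a, 'e) tensor2 \<Rightarrow> bool" where
  "continuous_energy M g \<longleftrightarrow> (\<forall>c\<in>atlas M.
     continuous_on ((snd c ` fst c) \<times> UNIV) (\<lambda>(z, x). chart_energy M g c z x) \<and>
     (\<forall>z\<in>snd c ` fst c. chart_energy M g c z 0 = 0))"

text \<open>The velocity computed with derivatives relative to the parameter set. For a C1 curve on a
  compact interval this is one-sided at the endpoints, where \<^const>\<open>velocity\<close> may be meaningless, and
  hence continuous on the whole interval.\<close>
definition velocity_within ::
  "('a, 'e::euclidean_space) manifold \<Rightarrow> (real \<Rightarrow> 'a) \<Rightarrow> real set \<Rightarrow> real \<Rightarrow> ('a, 'e) tvec" where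
  "velocity_within M \<gamma> S t = (\<lambda>c. if c \<in> charts_at M (\<gamma> t)
     then vector_derivative (snd c \<circ> \<gamma>) (at t within S) else 0)"

lemma velocity_within_interior:
  "a < t \<Longrightarrow> t < b \<Longrightarrow> velocity_within M \<gamma> {a..b} t = velocity M \<gamma> t"
  by (simp only: velocity_within_def velocity_def at_within_Icc_at)

text \<open>Chain rule for a map on the manifold along a curve, both expressed in one chart.\<close>
lemma has_vector_derivative_along_curve:
  assumes M: "smooth_manifold M" and c: "c \<in> charts_at M (\<gamma> t)" and t: "t \<in> S"
    and \<gamma>: "continuous_map (top_of_set S) (mtop M) \<gamma>"
    and D: "((snd c \<circ> \<gamma>) has_vector_derivative D) (at t within S)"
    and F: "((F \<circ> chart_inv c) has_derivative F') (at (snd c (\<gamma> t)))"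
  shows "((F \<circ> \<gamma>) has_vector_derivative F' D) (at t within S)"
proof -
  note cc = charts_atD[OF c]
  have "openin (top_of_set S) {x \<in> S. \<gamma> x \<in> fst c}"
    using openin_continuous_map_preimage[OF \<gamma> openin_chart_domain[OF M cc(1)]] by simp
  then obtain \<delta> where \<delta>: "\<delta> > 0" "\<And>x. x \<in> S \<Longrightarrow> dist x t < \<delta> \<Longrightarrow> \<gamma> x \<in> fst c"
    using t cc(2) unfolding openin_euclidean_subtopology_iff by blast
  have "((F \<circ> chart_inv c) has_derivative F') (at ((snd c \<circ> \<gamma>) t) within (snd c \<circ> \<gamma>) ` S)"
    using F by (simp add: has_derivative_at_withinI)
  from vector_derivative_diff_chain_within[OF D this]
  have "(((F \<circ> chart_inv c) \<circ> (snd c \<circ> \<gamma>)) has_vector_derivative F' D) (at t within S)" .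
  then show ?thesis
    by (rule has_vector_derivative_transform_within[OF _ \<delta>(1) t])
      (use \<delta>(2) chart_inv_chart[OF M cc(1)] in auto)
qed

lemma velocity_within_chart:
  assumes M: "smooth_manifold M" and ab: "a < b" and t: "t \<in> {a..b}"
    and \<gamma>: "continuous_map (top_of_set {a..b}) (mtop M) \<gamma>" and c: "c \<in> charts_at M (\<gamma> t)"
    and D: "((snd c \<circ> \<gamma>) has_vector_derivative D) (at t within {a..b})"
  shows "velocity_within M \<gamma> {a..b} t = coord_vec M c (\<gamma> t) D"
proof
  fix d
  show "velocity_within M \<gamma> {a..b} t d = coord_vec M c (\<gamma> t) D d"
  proof (cases "d \<in> charts_at M (\<gamma> t)")
    case d: True
    have "((snd d \<circ> \<gamma>) has_vector_derivative
       frechet_derivative (snd d \<circ> chart_inv c) (at (snd c (\<gamma> t))) D) (at t within {a..b})"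
      by (rule has_vector_derivative_along_curve[OF M c t \<gamma> D])
        (rule iffD1[OF frechet_derivative_works transition_differentiable[OF M c d]])
    from vector_derivative_within_closed_interval[OF ab t this] show ?thesis
      using d by (simp add: velocity_within_def coord_vec_def)
  qed (simp add: velocity_within_def coord_vec_def)
qed

lemma C1_curve_onD:
  assumes "C1_curve_on M \<gamma> a b"
  shows "continuous_map (top_of_set {a..b}) (mtop M) \<gamma>"
    and "\<And>t. t \<in> {a..b} \<Longrightarrow> \<gamma> t \<in> points M"
  using assms continuous_map_image_subset_topspace[of "top_of_set {a..b}" "mtop M" \<gamma>]
  by (auto simp: C1_curve_on_def)

lemma C1_curve_chart:
  assumes "C1_curve_on M \<gamma> a b" "c \<in> charts_at M (\<gamma> t)" "t \<in> {a..b}"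
  obtains D where "((snd c \<circ> \<gamma>) has_vector_derivative D) (at t within {a..b})"
  using assms unfolding C1_curve_on_def charts_at_def by blast

lemma velocity_within_tangent:
  assumes M: "smooth_manifold M" and ab: "a < b" and \<gamma>: "C1_curve_on M \<gamma> a b" and t: "t \<in> {a..b}"
  shows "velocity_within M \<gamma> {a..b} t \<in> tangent_space M (\<gamma> t)"
proof -
  obtain c where c: "c \<in> charts_at M (\<gamma> t)" using ex_chart[OF M C1_curve_onD(2)[OF \<gamma> t]] ..
  obtain D where D: "((snd c \<circ> \<gamma>) has_vector_derivative D) (at t within {a..b})"
    using C1_curve_chart[OF \<gamma> c t] .
  show ?thesis
    unfolding velocity_within_chart[OF M ab t C1_curve_onD(1)[OF \<gamma>] c D]
    by (rule coord_vec_in_tangent_space[OF M c])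
qed

text \<open>The speed that belongs to \<^const>\<open>velocity_within\<close>.\<close>
definition speed_within ::
  "('a, 'e::euclidean_space) manifold \<Rightarrow> ('a, 'e) tensor2 \<Rightarrow> (real \<Rightarrow> 'a) \<Rightarrow> real set \<Rightarrow> real \<Rightarrow> real" where
  "speed_within M g \<gamma> S t =
     sqrt (g (\<gamma> t) (velocity_within M \<gamma> S t) (velocity_within M \<gamma> S t))"

abbreviation speed ::
  "('a, 'e::euclidean_space) manifold \<Rightarrow> ('a, 'e) tensor2 \<Rightarrow> (real \<Rightarrow> 'a) \<Rightarrow> real \<Rightarrow> real" where
  "speed M g \<gamma> t \<equiv> sqrt (g (\<gamma> t) (velocity M \<gamma> t) (velocity M \<gamma> t))"

lemma continuous_on_speed_within:
  assumes M: "smooth_manifold M" and g: "continuous_energy M g"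
    and ab: "a < b" and \<gamma>: "C1_curve_on M \<gamma> a b"
  shows "continuous_on {a..b} (speed_within M g \<gamma> {a..b})"
  unfolding continuous_on_eq_continuous_within
proof
  fix t assume t: "t \<in> {a..b}"
  note cont = C1_curve_onD(1)[OF \<gamma>]
  obtain c where c: "c \<in> charts_at M (\<gamma> t)" using ex_chart[OF M C1_curve_onD(2)[OF \<gamma> t]] ..
  note cc = charts_atD[OF c]
  define T where "T = {t\<in>{a..b}. \<gamma> t \<in> fst c}"
  obtain D where Dc: "continuous_on T D"
    and D: "\<And>t. t \<in> T \<Longrightarrow> ((snd c \<circ> \<gamma>) has_vector_derivative D t) (at t within {a..b})"
    using \<gamma> cc(1) unfolding C1_curve_on_def T_def by blast
  have "openin (top_of_set {a..b}) T"
    using openin_continuous_map_preimage[OF cont openin_chart_domain[OF M cc(1)]] by (simp add: T_def)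
  then obtain U where U: "open U" "T = {a..b} \<inter> U" by (auto simp: openin_open)
  have eq: "speed_within M g \<gamma> {a..b} u = sqrt (chart_energy M g c (snd c (\<gamma> u)) (D u))" if "u \<in> T" for u
  proof -
    have u: "u \<in> {a..b}" "c \<in> charts_at M (\<gamma> u)" using that cc by (auto simp: T_def charts_at_def)
    show ?thesis
      using velocity_within_chart[OF M ab u(1) cont u(2) D[OF that]] u(2)
      by (simp add: speed_within_def chart_energy_def Let_def chart_inv_chart[OF M] charts_atD)
  qed
  have "(snd c \<circ> \<gamma>) differentiable (at u within T)" if "u \<in> T" for u
    using D[OF that] U(2) by (metis differentiableI_vector differentiable_within_subset inf_le1)
  then have "continuous_on T (snd c \<circ> \<gamma>)"
    by (meson continuous_on_eq_continuous_within differentiable_imp_continuous_within)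
  then have "continuous_on T (\<lambda>u. (snd c (\<gamma> u), D u))"
    using Dc by (intro continuous_intros) (simp_all add: o_def)
  moreover have "continuous_on ((snd c ` fst c) \<times> UNIV) (\<lambda>(z, x). chart_energy M g c z x)"
    using g cc(1) by (simp add: continuous_energy_def)
  moreover have "(\<lambda>u. (snd c (\<gamma> u), D u)) ` T \<subseteq> (snd c ` fst c) \<times> UNIV"
    by (auto simp: T_def)
  ultimately have "continuous_on T (\<lambda>u. (\<lambda>(z, x). chart_energy M g c z x) (snd c (\<gamma> u), D u))"
    using continuous_on_compose2 by blast
  then have "continuous_on T (\<lambda>u. sqrt (chart_energy M g c (snd c (\<gamma> u)) (D u)))"
    by (intro continuous_intros) simp
  then have "continuous_on T (speed_within M g \<gamma> {a..b})"
    by (rule continuous_on_eq) (simp add: eq)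
  moreover have "t \<in> T" using t cc(2) by (simp add: T_def)
  ultimately have "continuous (at t within T) (speed_within M g \<gamma> {a..b})"
    by (simp add: continuous_on_eq_continuous_within)
  moreover have "at t within T = at t within {a..b}"
    by (rule at_within_nhd[of t U]) (use \<open>t \<in> T\<close> U in auto)
  ultimately show "continuous (at t within {a..b}) (speed_within M g \<gamma> {a..b})" by simp
qed

lemma speed_has_integral:
  assumes M: "smooth_manifold M" and g: "continuous_energy M g"
    and ab: "a < b" and \<gamma>: "C1_curve_on M \<gamma> a b"
  shows "(speed M g \<gamma> has_integral integral {a..b} (speed_within M g \<gamma> {a..b})) {a..b}"
proof (rule has_integral_spike_finite)
  show "finite {a, b}" by simp
  show "(speed_within M g \<gamma> {a..b} has_integral integral {a..b} (speed_within M g \<gamma> {a..b})) {a..b}"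
    by (intro integrable_integral integrable_continuous_real continuous_on_speed_within assms)
  show "speed M g \<gamma> t = speed_within M g \<gamma> {a..b} t" if "t \<in> {a..b} - {a, b}" for t
    using that velocity_within_interior[of a t b M \<gamma>] by (auto simp: speed_within_def)
qed

text \<open>A function whose differential is bounded by \<^term>\<open>g\<close> does not grow faster than arc length:
  integrate \<open>d\<phi>(\<gamma>')\<close>, which is at most the speed.\<close>
lemma C1_curve_increment_le:
  assumes M: "smooth_manifold M" and g: "continuous_energy M g"
    and \<phi>: "\<And>p c. c \<in> charts_at M p \<Longrightarrow> (\<phi> \<circ> chart_inv c) differentiable (at (snd c p))"
    and le: "\<And>p v. p \<in> points M \<Longrightarrow> v \<in> tangent_space M p \<Longrightarrow> (dfun M \<phi> p v)\<^sup>2 \<le> g p v v"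
    and ab: "a < b" and \<gamma>: "C1_curve_on M \<gamma> a b"
  shows "\<bar>\<phi> (\<gamma> b) - \<phi> (\<gamma> a)\<bar> \<le> integral {a..b} (speed M g \<gamma>)"
proof -
  let ?W = "velocity_within M \<gamma> {a..b}"
  have "((\<phi> \<circ> \<gamma>) has_vector_derivative dfun M \<phi> (\<gamma> t) (?W t)) (at t within {a..b})"
    if t: "t \<in> {a..b}" for t
  proof -
    note cont = C1_curve_onD(1)[OF \<gamma>]
    obtain c where c: "c \<in> charts_at M (\<gamma> t)" using ex_chart[OF M C1_curve_onD(2)[OF \<gamma> t]] ..
    obtain D where D: "((snd c \<circ> \<gamma>) has_vector_derivative D) (at t within {a..b})"
      using C1_curve_chart[OF \<gamma> c t] .
    have "?W t c = D"
      by (simp add: velocity_within_chart[OF M ab t cont c D] coord_vec_same[OF M c])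
    then have "dfun M \<phi> (\<gamma> t) (?W t) = frechet_derivative (\<phi> \<circ> chart_inv c) (at (snd c (\<gamma> t))) D"
      using dfun_eq[OF M c velocity_within_tangent[OF M ab \<gamma> t] \<phi>] by simp
    then show ?thesis
      using has_vector_derivative_along_curve[OF M c t cont D iffD1[OF frechet_derivative_works \<phi>[OF c]]]
      by simp
  qed
  then have int: "((\<lambda>t. dfun M \<phi> (\<gamma> t) (?W t)) has_integral (\<phi> \<circ> \<gamma>) b - (\<phi> \<circ> \<gamma>) a) {a..b}"
    using ab by (intro fundamental_theorem_of_calculus) (simp_all only: less_imp_le)
  have "norm (integral {a..b} (\<lambda>t. dfun M \<phi> (\<gamma> t) (?W t))) \<le> integral {a..b} (speed_within M g \<gamma> {a..b})"
  proof (rule integral_norm_bound_integral)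
    show "(\<lambda>t. dfun M \<phi> (\<gamma> t) (?W t)) integrable_on {a..b}" using int by blast
    show "speed_within M g \<gamma> {a..b} integrable_on {a..b}"
      by (intro integrable_continuous_real continuous_on_speed_within M g ab \<gamma>)
    show "norm (dfun M \<phi> (\<gamma> t) (?W t)) \<le> speed_within M g \<gamma> {a..b} t" if t: "t \<in> {a..b}" for t
      using real_sqrt_le_mono[OF le[OF C1_curve_onD(2)[OF \<gamma> t] velocity_within_tangent[OF M ab \<gamma> t]]]
      by (simp add: speed_within_def)
  qed
  then show ?thesis
    using int speed_has_integral[OF M g ab \<gamma>] by (simp add: integral_unique)
qed

lemma piecewise_C1_curve:
  assumes M: "smooth_manifold M" and g: "continuous_energy M g"
    and \<gamma>: "piecewise_C1_curve_on M \<gamma> a b"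
  shows speed_integrable: "speed M g \<gamma> integrable_on {a..b}"
    and increment_le_curve_length:
      "\<lbrakk>\<And>p c. c \<in> charts_at M p \<Longrightarrow> (\<phi> \<circ> chart_inv c) differentiable (at (snd c p));
        \<And>p v. p \<in> points M \<Longrightarrow> v \<in> tangent_space M p \<Longrightarrow> (dfun M \<phi> p v)\<^sup>2 \<le> g p v v\<rbrakk>
       \<Longrightarrow> \<bar>\<phi> (\<gamma> b) - \<phi> (\<gamma> a)\<bar> \<le> curve_length M g \<gamma> a b"
proof -
  obtain n s where s: "s 0 = a" "s n = b"
    and piece: "\<And>k. k < n \<Longrightarrow> s k < s (Suc k)" "\<And>k. k < n \<Longrightarrow> C1_curve_on M \<gamma> (s k) (s (Suc k))"
    using \<gamma> unfolding piecewise_C1_curve_on_def by blast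
  have mono: "s 0 \<le> s k" if "k \<le> n" for k
    using that
  proof (induction k)
    case (Suc k)
    then show ?case using piece(1)[of k] by simp
  qed simp
  have int: "speed M g \<gamma> integrable_on {s 0..s k}" if "k \<le> n" for k
    using that
  proof (induction k)
    case (Suc k)
    then have k: "k < n" by simp
    show ?case
    proof (rule Henstock_Kurzweil_Integration.integrable_combine)
      show "s 0 \<le> s k" "s k \<le> s (Suc k)" using k mono[of k] piece(1)[of k] by simp_all
      show "speed M g \<gamma> integrable_on {s 0..s k}" using Suc by simp
      show "speed M g \<gamma> integrable_on {s k..s (Suc k)}"
        by (rule has_integral_integrable[OF speed_has_integral[OF M g piece[OF k]]])
    qed
  qed (use integrable_on_refl[of "speed M g \<gamma>" "s 0"] in simp)
  from int[of n] show "speed M g \<gamma> integrable_on {a..b}" by (simp add: s)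
  assume \<phi>: "\<And>p c. c \<in> charts_at M p \<Longrightarrow> (\<phi> \<circ> chart_inv c) differentiable (at (snd c p))"
    and le: "\<And>p v. p \<in> points M \<Longrightarrow> v \<in> tangent_space M p \<Longrightarrow> (dfun M \<phi> p v)\<^sup>2 \<le> g p v v"
  have "\<bar>\<phi> (\<gamma> (s k)) - \<phi> (\<gamma> (s 0))\<bar> \<le> integral {s 0..s k} (speed M g \<gamma>)" if "k \<le> n" for k
    using that
  proof (induction k)
    case (Suc k)
    then have k: "k < n" by simp
    have "\<bar>\<phi> (\<gamma> (s (Suc k))) - \<phi> (\<gamma> (s k))\<bar> \<le> integral {s k..s (Suc k)} (speed M g \<gamma>)"
      by (rule C1_curve_increment_le[OF M g \<phi> le piece[OF k]])
    moreover have "integral {s 0..s k} (speed M g \<gamma>) + integral {s k..s (Suc k)} (speed M g \<gamma>)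
        = integral {s 0..s (Suc k)} (speed M g \<gamma>)"
    proof (rule Henstock_Kurzweil_Integration.integral_combine)
      show "s 0 \<le> s k" "s k \<le> s (Suc k)" using k mono[of k] piece(1)[of k] by simp_all
    qed (rule int[OF Suc.prems])
    moreover have "\<bar>\<phi> (\<gamma> (s k)) - \<phi> (\<gamma> (s 0))\<bar> \<le> integral {s 0..s k} (speed M g \<gamma>)"
      using Suc by simp
    ultimately show ?case by linarith
  qed simp
  from this[of n] show "\<bar>\<phi> (\<gamma> b) - \<phi> (\<gamma> a)\<bar> \<le> curve_length M g \<gamma> a b"
    by (simp add: s curve_length_def)
qed


section \<open>The distance function\<close>

lemma C1_curve_on_cong:
  assumes "C1_curve_on M \<gamma> a b" and eq: "\<And>t. t \<in> {a..b} \<Longrightarrow> \<gamma>' t = \<gamma> t"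
  shows "C1_curve_on M \<gamma>' a b"
proof -
  have cont: "continuous_map (top_of_set {a..b}) (mtop M) \<gamma>"
    and D: "\<forall>c\<in>atlas M. \<exists>D. continuous_on {t\<in>{a..b}. \<gamma> t \<in> fst c} D \<and>
        (\<forall>t\<in>{a..b}. \<gamma> t \<in> fst c \<longrightarrow>
           ((snd c \<circ> \<gamma>) has_vector_derivative D t) (at t within {a..b}))"
    by (rule conjunct1[OF assms(1)[unfolded C1_curve_on_def]],
        rule conjunct2[OF assms(1)[unfolded C1_curve_on_def]])
  have "continuous_map (top_of_set {a..b}) (mtop M) \<gamma>'"
    by (rule continuous_map_eq[OF cont]) (simp add: eq)
  moreover have "\<exists>D. continuous_on {t\<in>{a..b}. \<gamma>' t \<in> fst c} D \<and>
        (\<forall>t\<in>{a..b}. \<gamma>' t \<in> fst c \<longrightarrow>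
           ((snd c \<circ> \<gamma>') has_vector_derivative D t) (at t within {a..b}))" if c: "c \<in> atlas M" for c
  proof -
    obtain D where "continuous_on {t\<in>{a..b}. \<gamma> t \<in> fst c} D"
      and D: "\<And>t. t \<in> {a..b} \<Longrightarrow> \<gamma> t \<in> fst c \<Longrightarrow>
           ((snd c \<circ> \<gamma>) has_vector_derivative D t) (at t within {a..b})"
      using bspec[OF D c] by blast
    moreover have "{t\<in>{a..b}. \<gamma>' t \<in> fst c} = {t\<in>{a..b}. \<gamma> t \<in> fst c}" by (auto simp: eq)
    moreover have "((snd c \<circ> \<gamma>') has_vector_derivative D t) (at t within {a..b})"
      if "t \<in> {a..b}" "\<gamma>' t \<in> fst c" for t
      by (rule has_vector_derivative_transform[OF that(1) _ D[OF that(1)]])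
        (use that eq in auto)
    ultimately show ?thesis by (intro exI[of _ D]) simp
  qed
  ultimately show ?thesis by (simp add: C1_curve_on_def)
qed

lemma C1_curve_on_shift:
  assumes \<gamma>: "C1_curve_on M \<gamma> a b"
  shows "C1_curve_on M (\<lambda>t. \<gamma> (t - r)) (a + r) (b + r)"
  unfolding C1_curve_on_def
proof (intro conjI ballI)
  let ?\<sigma> = "\<lambda>t. t - r"
  have img: "?\<sigma> ` {a + r..b + r} = {a..b}" by (simp add: image_diff_atLeastAtMost)
  have "continuous_map (top_of_set {a + r..b + r}) (top_of_set {a..b}) ?\<sigma>"
    using img by (auto simp: continuous_map_in_subtopology intro!: continuous_intros)
  from continuous_map_compose[OF this C1_curve_onD(1)[OF \<gamma>]]
  show "continuous_map (top_of_set {a + r..b + r}) (mtop M) (\<lambda>t. \<gamma> (t - r))"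
    by (simp add: o_def)
  fix c assume "c \<in> atlas M"
  then obtain D where cont: "continuous_on {t\<in>{a..b}. \<gamma> t \<in> fst c} D"
    and D: "\<And>t. t \<in> {a..b} \<Longrightarrow> \<gamma> t \<in> fst c \<Longrightarrow>
       ((snd c \<circ> \<gamma>) has_vector_derivative D t) (at t within {a..b})"
    using \<gamma> unfolding C1_curve_on_def by blast
  have "continuous_on {t\<in>{a + r..b + r}. \<gamma> (t - r) \<in> fst c} (\<lambda>t. D (t - r))"
    by (rule continuous_on_compose2[OF cont]) (auto intro!: continuous_intros)
  moreover have "((snd c \<circ> (\<lambda>t. \<gamma> (t - r))) has_vector_derivative D (t - r)) (at t within {a + r..b + r})"
    if t: "t \<in> {a + r..b + r}" "\<gamma> (t - r) \<in> fst c" for t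
  proof -
    have "(?\<sigma> has_vector_derivative 1) (at t within {a + r..b + r})"
      by (auto intro!: derivative_eq_intros)
    moreover have "((snd c \<circ> \<gamma>) has_vector_derivative D (t - r)) (at (?\<sigma> t) within ?\<sigma> ` {a + r..b + r})"
      using D[of "t - r"] t by (simp add: img)
    ultimately have "(((snd c \<circ> \<gamma>) \<circ> ?\<sigma>) has_vector_derivative 1 *\<^sub>R D (t - r)) (at t within {a + r..b + r})"
      by (rule vector_diff_chain_within)
    then show ?thesis by (simp add: o_def)
  qed
  ultimately show "\<exists>D. continuous_on {t\<in>{a + r..b + r}. \<gamma> (t - r) \<in> fst c} D \<and>
     (\<forall>t\<in>{a + r..b + r}. \<gamma> (t - r) \<in> fst c \<longrightarrow>
        ((snd c \<circ> (\<lambda>t. \<gamma> (t - r))) has_vector_derivative D t) (at t within {a + r..b + r}))"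
    by (intro exI[of _ "\<lambda>t. D (t - r)"]) simp
qed

lemma velocity_shift:
  fixes M :: "('a, 'e::euclidean_space) manifold"
  shows "velocity M (\<lambda>t. \<gamma> (t - r)) t = velocity M \<gamma> (t - r)"
proof -
  have *: "((\<lambda>t. F (t - r)) has_vector_derivative D) (at t)" if "(F has_vector_derivative D) (at (t - r))"
    for F :: "real \<Rightarrow> 'e" and D t r
  proof -
    have "((\<lambda>t. t - r) has_vector_derivative 1) (at t)" by (auto intro!: derivative_eq_intros)
    from vector_diff_chain_at[OF this, of F D] that show ?thesis by (simp add: o_def)
  qed
  have "((\<lambda>t. F (t - r)) has_vector_derivative D) (at t) \<longleftrightarrow> (F has_vector_derivative D) (at (t - r))"
    for F :: "real \<Rightarrow> 'e" and D
    using *[of F D t r] *[of "\<lambda>t. F (t - r)" D "t - r" "- r"] by auto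
  then have "vector_derivative (\<lambda>t. F (t - r)) (at t) = vector_derivative F (at (t - r))"
    for F :: "real \<Rightarrow> 'e" by (simp add: vector_derivative_def)
  from this[of "snd c \<circ> \<gamma>" for c :: "('a, 'e) chart"] show ?thesis by (simp add: velocity_def o_def cong: if_cong)
qed

lemma velocity_cong:
  fixes M :: "('a, 'e::euclidean_space) manifold"
  assumes "open S" "t \<in> S" and eq: "\<And>s. s \<in> S \<Longrightarrow> \<gamma>' s = \<gamma> s"
  shows "velocity M \<gamma>' t = velocity M \<gamma> t"
proof -
  have "\<forall>\<^sub>F s in nhds t. \<gamma>' s = \<gamma> s"
    using eventually_nhds_in_open[OF assms(1,2)] by (rule eventually_mono) (rule eq)
  then have "\<forall>\<^sub>F s in nhds t. s \<in> UNIV \<longrightarrow> (snd c \<circ> \<gamma>') s = (snd c \<circ> \<gamma>) s" for c :: "('a, 'e) chart"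
    by (rule eventually_mono) simp
  then have "vector_derivative (snd c \<circ> \<gamma>') (at t) = vector_derivative (snd c \<circ> \<gamma>) (at t)"
    for c :: "('a, 'e) chart"
    by (rule vector_derivative_cong_eq) auto
  then show ?thesis by (simp add: velocity_def eq[OF assms(2)] cong: if_cong)
qed

lemma piecewise_C1_curve_on_shift:
  assumes "piecewise_C1_curve_on M \<gamma> a b"
  shows "piecewise_C1_curve_on M (\<lambda>t. \<gamma> (t - r)) (a + r) (b + r)"
proof -
  obtain n s where "a < b" "s 0 = a" "s n = b"
    "\<And>k. k < n \<Longrightarrow> s k < s (Suc k) \<and> C1_curve_on M \<gamma> (s k) (s (Suc k))"
    using assms unfolding piecewise_C1_curve_on_def by blast
  then show ?thesis
    unfolding piecewise_C1_curve_on_def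
    by (intro conjI exI[of _ n] exI[of _ "\<lambda>k. s k + r"]) (auto intro: C1_curve_on_shift)
qed

lemma curve_length_shift:
  "curve_length M g (\<lambda>t. \<gamma> (t - r)) (a + r) (b + r) = curve_length M g \<gamma> a b"
  using integral_shift_real_ivl[where c = "- r" and a = a and b = b and f = "speed M g \<gamma>"]
  by (simp add: curve_length_def velocity_shift)

lemma piecewise_C1_curve_on_join:
  assumes \<gamma>: "piecewise_C1_curve_on M \<gamma> a b" and \<gamma>': "piecewise_C1_curve_on M \<gamma>' b c"
    and eq: "\<gamma> b = \<gamma>' b"
  shows "piecewise_C1_curve_on M (\<lambda>t. if t \<le> b then \<gamma> t else \<gamma>' t) a c"
proof -
  let ?\<eta> = "\<lambda>t. if t \<le> b then \<gamma> t else \<gamma>' t"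
  obtain n s where ab: "a < b" and s: "s 0 = a" "s n = b" and
    piece: "\<And>k. k < n \<Longrightarrow> s k < s (Suc k)" "\<And>k. k < n \<Longrightarrow> C1_curve_on M \<gamma> (s k) (s (Suc k))"
    using \<gamma> unfolding piecewise_C1_curve_on_def by blast
  obtain n' s' where bc: "b < c" and s': "s' 0 = b" "s' n' = c" and
    piece': "\<And>k. k < n' \<Longrightarrow> s' k < s' (Suc k)" "\<And>k. k < n' \<Longrightarrow> C1_curve_on M \<gamma>' (s' k) (s' (Suc k))"
    using \<gamma>' unfolding piecewise_C1_curve_on_def by blast
  have le: "s k \<le> b" if "k \<le> n" for k
    using that
  proof (induction k rule: inc_induct)
    case (step m)
    then show ?case using piece(1)[of m] by linarith
  qed (simp add: s)
  have ge: "b \<le> s' k" if "k \<le> n'" for k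
    using that
  proof (induction k)
    case (Suc k)
    then show ?case using piece'(1)[of k] by simp
  qed (simp add: s')
  define u where "u k = (if k \<le> n then s k else s' (k - n))" for k
  have "u k < u (Suc k) \<and> C1_curve_on M ?\<eta> (u k) (u (Suc k))" if k: "k < n + n'" for k
  proof (cases "k < n")
    case True
    then have "u k = s k" "u (Suc k) = s (Suc k)" by (auto simp: u_def)
    moreover have "C1_curve_on M ?\<eta> (s k) (s (Suc k))"
      by (rule C1_curve_on_cong[OF piece(2)[OF True]]) (use le[of "Suc k"] True in auto)
    ultimately show ?thesis using piece(1)[OF True] by simp
  next
    case False
    then have k': "k - n < n'" and "u k = s' (k - n)" "u (Suc k) = s' (Suc (k - n))"
      using k s s' by (auto simp: u_def Suc_diff_le)
    moreover have "C1_curve_on M ?\<eta> (s' (k - n)) (s' (Suc (k - n)))"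
    proof (rule C1_curve_on_cong[OF piece'(2)[OF k']])
      fix t assume "t \<in> {s' (k - n)..s' (Suc (k - n))}"
      then have "t \<le> b \<longrightarrow> t = b" using ge[of "k - n"] k' by simp
      then show "?\<eta> t = \<gamma>' t" using eq by auto
    qed
    ultimately show ?thesis using piece'(1)[OF k'] by simp
  qed
  moreover have "u 0 = a" "u (n + n') = c" using s s' by (auto simp: u_def)
  ultimately show ?thesis
    unfolding piecewise_C1_curve_on_def using less_trans[OF ab bc]
    by (intro conjI exI[of _ "n + n'"] exI[of _ u]) auto
qed

text \<open>The velocity of the joined curve at the single junction parameter does not affect the
  integral. Integrability of both speeds is essential, since a non-integrable function has integral 0
  by convention.\<close>
lemma curve_length_join:
  assumes M: "smooth_manifold M" and g: "continuous_energy M g"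
    and \<gamma>: "piecewise_C1_curve_on M \<gamma> a b" and \<gamma>': "piecewise_C1_curve_on M \<gamma>' b c"
  shows "curve_length M g (\<lambda>t. if t \<le> b then \<gamma> t else \<gamma>' t) a c =
     curve_length M g \<gamma> a b + curve_length M g \<gamma>' b c"
proof -
  let ?\<eta> = "\<lambda>t. if t \<le> b then \<gamma> t else \<gamma>' t"
  have ab: "a < b" "b < c" using \<gamma> \<gamma>' by (auto simp: piecewise_C1_curve_on_def)
  have "(speed M g ?\<eta> has_integral curve_length M g \<gamma> a b) {a..b}"
  proof (rule has_integral_spike_finite[of "{b}"])
    show "(speed M g \<gamma> has_integral curve_length M g \<gamma> a b) {a..b}"
      unfolding curve_length_def by (rule integrable_integral[OF speed_integrable[OF M g \<gamma>]])
    show "speed M g ?\<eta> t = speed M g \<gamma> t" if "t \<in> {a..b} - {b}" for t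
      using that velocity_cong[of "{..<b}" t ?\<eta> \<gamma> M] by auto
  qed simp
  moreover have "(speed M g ?\<eta> has_integral curve_length M g \<gamma>' b c) {b..c}"
  proof (rule has_integral_spike_finite[of "{b}"])
    show "(speed M g \<gamma>' has_integral curve_length M g \<gamma>' b c) {b..c}"
      unfolding curve_length_def by (rule integrable_integral[OF speed_integrable[OF M g \<gamma>']])
    show "speed M g ?\<eta> t = speed M g \<gamma>' t" if "t \<in> {b..c} - {b}" for t
      using that velocity_cong[of "{b<..}" t ?\<eta> \<gamma>' M] by auto
  qed simp
  ultimately have "(speed M g ?\<eta> has_integral curve_length M g \<gamma> a b + curve_length M g \<gamma>' b c) {a..c}"
    by (rule has_integral_combine[OF less_imp_le[OF ab(1)] less_imp_le[OF ab(2)]])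
  then show ?thesis
    unfolding curve_length_def[of M g ?\<eta>] by (rule integral_unique)
qed

lemma riemannian_dist_less_iff:
  "riemannian_dist M g p q < ereal x \<longleftrightarrow>
     (\<exists>\<gamma> a b. piecewise_C1_curve_on M \<gamma> a b \<and> \<gamma> a = p \<and> \<gamma> b = q \<and> curve_length M g \<gamma> a b < x)"
  (is "?L \<longleftrightarrow> (\<exists>\<gamma> a b. ?P \<gamma> a b)")
proof
  assume ?L
  then obtain l where "l \<in> {ereal (curve_length M g \<gamma> a b) |\<gamma> a b.
      piecewise_C1_curve_on M \<gamma> a b \<and> \<gamma> a = p \<and> \<gamma> b = q}" and l: "l < ereal x"
    unfolding riemannian_dist_def Inf_less_iff by (rule bexE)
  then obtain \<gamma> a b where "l = ereal (curve_length M g \<gamma> a b)"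
    "piecewise_C1_curve_on M \<gamma> a b \<and> \<gamma> a = p \<and> \<gamma> b = q"
    unfolding mem_Collect_eq by blast
  then have "?P \<gamma> a b" using l by simp
  then show "\<exists>\<gamma> a b. ?P \<gamma> a b" by (intro exI)
next
  assume "\<exists>\<gamma> a b. ?P \<gamma> a b"
  then obtain \<gamma> a b where P: "?P \<gamma> a b" by (elim exE)
  have "riemannian_dist M g p q \<le> ereal (curve_length M g \<gamma> a b)"
    unfolding riemannian_dist_def mem_Collect_eq
    by (intro Inf_lower CollectI exI[of _ \<gamma>] exI[of _ a] exI[of _ b]) (use P in simp)
  then show ?L using P by (auto elim: le_less_trans)
qed

lemma riemannian_dist_triangle:
  assumes M: "smooth_manifold M" and g: "continuous_energy M g"
    and x: "riemannian_dist M g p q < ereal x" and y: "riemannian_dist M g q r < ereal y"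
  shows "riemannian_dist M g p r < ereal (x + y)"
proof -
  obtain \<gamma> a b where \<gamma>: "piecewise_C1_curve_on M \<gamma> a b" "\<gamma> a = p" "\<gamma> b = q" "curve_length M g \<gamma> a b < x"
    using x unfolding riemannian_dist_less_iff by blast
  obtain \<gamma>' a' b' where \<gamma>': "piecewise_C1_curve_on M \<gamma>' a' b'" "\<gamma>' a' = q" "\<gamma>' b' = r"
    "curve_length M g \<gamma>' a' b' < y"
    using y unfolding riemannian_dist_less_iff by blast
  define \<gamma>'' c where "\<gamma>'' = (\<lambda>t. \<gamma>' (t - (b - a')))" and "c = b' + (b - a')"
  \<comment> \<open>Shift the second curve so that its parameter interval starts where the first one ends.\<close>
  have b: "a' + (b - a') = b" by simp
  have \<gamma>'': "piecewise_C1_curve_on M \<gamma>'' b c" "curve_length M g \<gamma>'' b c < y"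
    using piecewise_C1_curve_on_shift[OF \<gamma>'(1), of "b - a'"] \<gamma>'(4)
    unfolding curve_length_shift[of M g \<gamma>' "b - a'" a' b', symmetric] \<gamma>''_def c_def b
    by -
  have ends: "\<gamma>'' b = q" "\<gamma>'' c = r" using \<gamma>' by (simp_all add: \<gamma>''_def c_def)
  let ?\<eta> = "\<lambda>t. if t \<le> b then \<gamma> t else \<gamma>'' t"
  have "a < b" "b < c" using \<gamma>(1) \<gamma>''(1) by (auto simp: piecewise_C1_curve_on_def)
  then have "?\<eta> a = p" "?\<eta> c = r" using \<gamma>(2) ends(2) by simp_all
  moreover have "piecewise_C1_curve_on M ?\<eta> a c"
    by (rule piecewise_C1_curve_on_join[OF \<gamma>(1) \<gamma>''(1)]) (simp add: \<gamma>(3) ends)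
  moreover have "curve_length M g ?\<eta> a c < x + y"
    using curve_length_join[OF M g \<gamma>(1) \<gamma>''(1)] \<gamma>(4) \<gamma>''(2) by simp
  ultimately show ?thesis
    unfolding riemannian_dist_less_iff
    by (intro exI[of _ ?\<eta>] exI[of _ a] exI[of _ c] conjI)
qed

lemma increment_le_riemannian_dist:
  assumes M: "smooth_manifold M" and g: "continuous_energy M g"
    and \<phi>: "\<And>p c. c \<in> charts_at M p \<Longrightarrow> (\<phi> \<circ> chart_inv c) differentiable (at (snd c p))"
    and le: "\<And>p v. p \<in> points M \<Longrightarrow> v \<in> tangent_space M p \<Longrightarrow> (dfun M \<phi> p v)\<^sup>2 \<le> g p v v"
  shows "ereal \<bar>\<phi> q - \<phi> p\<bar> \<le> riemannian_dist M g p q"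
proof (rule ccontr)
  assume "\<not> ?thesis"
  then have "riemannian_dist M g p q < ereal \<bar>\<phi> q - \<phi> p\<bar>" by (simp only: not_le)
  then obtain \<gamma> a b where \<gamma>: "piecewise_C1_curve_on M \<gamma> a b" "\<gamma> a = p" "\<gamma> b = q"
    "curve_length M g \<gamma> a b < \<bar>\<phi> q - \<phi> p\<bar>"
    unfolding riemannian_dist_less_iff by blast
  have "\<bar>\<phi> (\<gamma> b) - \<phi> (\<gamma> a)\<bar> \<le> curve_length M g \<gamma> a b"
    by (rule increment_le_curve_length[OF M g \<gamma>(1)]) (rule \<phi>, assumption, rule le, assumption+)
  then show False using \<gamma>(4) unfolding \<gamma>(2,3) by linarith
qed


section \<open>A completeness criterion\<close>

lemma C1_curve_on_chart_segment:
  assumes M: "smooth_manifold M" and c: "c \<in> atlas M"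
    and seg: "\<And>t. t \<in> {0..1} \<Longrightarrow> y + t *\<^sub>R w \<in> snd c ` fst c"
  shows "C1_curve_on M (\<lambda>t. chart_inv c (y + t *\<^sub>R w)) 0 1"
  unfolding C1_curve_on_def
proof (intro conjI ballI)
  let ?l = "\<lambda>t. y + t *\<^sub>R w" and ?\<gamma> = "\<lambda>t. chart_inv c (y + t *\<^sub>R w)"
  have l: "continuous_on S ?l" for S by (intro continuous_intros)
  have "continuous_map (top_of_set {0..1}) (top_of_set (snd c ` fst c)) ?l"
    unfolding continuous_map_in_subtopology using seg l[of "{0..1}"] by auto
  from continuous_map_compose[OF this continuous_map_chart_inv[OF M c]]
  show "continuous_map (top_of_set {0..1}) (mtop M) ?\<gamma>" by (simp add: o_def)
  fix d assume d: "d \<in> atlas M"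
  define T where "T = {t\<in>{0..1}. ?\<gamma> t \<in> fst d}"
  define D where "D t = frechet_derivative (snd d \<circ> chart_inv c) (at (?l t)) w" for t
  have lT: "?l t \<in> snd c ` (fst c \<inter> fst d)" if "t \<in> T" for t
  proof -
    have "?\<gamma> t \<in> fst c \<inter> fst d" using that chart_inv_in[OF seg[of t]] by (simp add: T_def)
    moreover have "snd c (?\<gamma> t) = ?l t" using that chart_chart_inv[OF seg[of t]] by (simp add: T_def)
    ultimately show ?thesis by (metis imageI)
  qed
  have sm: "smooth_on (snd c ` (fst c \<inter> fst d)) (snd d \<circ> chart_inv c)"
    using M c d by (simp add: smooth_manifold_def)
  have "continuous_on T D"
    unfolding D_def by (rule continuous_on_compose2[OF smooth_on_derivative_continuous_on[OF sm] l]) (use lT in auto)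
  moreover have "((snd d \<circ> ?\<gamma>) has_vector_derivative D t) (at t within {0..1})" if t: "t \<in> T" for t
  proof -
    have "(?l has_vector_derivative w) (at t within {0..1})"
      by (auto intro!: derivative_eq_intros)
    moreover have "((snd d \<circ> chart_inv c) has_derivative
        frechet_derivative (snd d \<circ> chart_inv c) (at (?l t))) (at (?l t) within ?l ` {0..1})"
      by (rule has_derivative_at_withinI, rule iffD1[OF frechet_derivative_works])
        (rule smooth_on_differentiable[OF sm lT[OF t]])
    ultimately have "((snd d \<circ> chart_inv c) \<circ> ?l has_vector_derivative D t) (at t within {0..1})"
      unfolding D_def by (rule vector_derivative_diff_chain_within)
    then show ?thesis by (simp add: o_def)
  qed
  ultimately show "\<exists>D. continuous_on {t\<in>{0..1}. ?\<gamma> t \<in> fst d} D \<and>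
      (\<forall>t\<in>{0..1}. ?\<gamma> t \<in> fst d \<longrightarrow> ((snd d \<circ> ?\<gamma>) has_vector_derivative D t) (at t within {0..1}))"
    by (intro exI[of _ D]) (simp add: T_def)
qed

text \<open>The manifold topology is finer than the topology of the distance: a point near \<^term>\<open>p\<close> is
  joined to \<^term>\<open>p\<close> by a straight coordinate segment of small constant coordinate velocity, and the
  energy is small near the zero vector over \<^term>\<open>p\<close>.\<close>
lemma riemannian_dist_small_nbhd:
  assumes M: "smooth_manifold M" and g: "continuous_energy M g" and p: "p \<in> points M" and e: "e > 0"
  shows "\<exists>U. openin (mtop M) U \<and> p \<in> U \<and> (\<forall>q\<in>U. riemannian_dist M g q p < ereal e)"
proof -
  obtain c where c: "c \<in> charts_at M p" using ex_chart[OF M p] ..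
  note cc = charts_atD[OF c]
  let ?Q = "\<lambda>(z, x). chart_energy M g c z x" and ?V = "snd c ` fst c" and ?x = "snd c p"
  have x: "?x \<in> ?V" using cc by simp
  have V: "open ?V" by (rule open_chart_image[OF M cc(1)])
  have Q: "continuous_on (?V \<times> UNIV) ?Q" "?Q (?x, 0) = 0"
    using g cc(1) x by (auto simp: continuous_energy_def)
  have "isCont ?Q (?x, 0)"
    using bspec[OF Q(1)[unfolded continuous_on_eq_continuous_at[OF open_Times[OF V open_UNIV]]], of "(?x, 0)"] x
    by simp
  then obtain d where d: "d > 0" "\<And>z. dist z (?x, 0) < d \<Longrightarrow> dist (?Q z) (?Q (?x, 0)) < (e/2)\<^sup>2"
    using e unfolding continuous_at_eps_delta by (meson half_gt_zero zero_less_power)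
  obtain r where r: "r > 0" "ball ?x r \<subseteq> ?V"
    using V x unfolding open_contains_ball by blast
  define \<delta> where "\<delta> = min r (d/2)"
  have \<delta>: "\<delta> > 0" "\<delta> \<le> r" "\<delta> \<le> d/2" using d r by (auto simp: \<delta>_def)
  define U where "U = {q \<in> topspace (subtopology (mtop M) (fst c)). snd c q \<in> ball ?x \<delta>}"
  have "openin (subtopology (mtop M) (fst c)) U"
    unfolding U_def by (rule openin_continuous_map_preimage[OF continuous_map_chart[OF M cc(1)]]) simp
  then have "openin (mtop M) U"
    using openin_trans_full openin_chart_domain[OF M cc(1)] by blast
  moreover have "p \<in> U" using p cc \<delta> by (simp add: U_def)
  moreover have "riemannian_dist M g q p < ereal e" if q: "q \<in> U" for q
  proof -
    define y w \<gamma> where "y = snd c q" and "w = ?x - y" and "\<gamma> = (\<lambda>t. chart_inv c (y + t *\<^sub>R w))"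
    have y: "dist y ?x < \<delta>" "q \<in> fst c" using q by (auto simp: U_def y_def dist_commute)
    \<comment> \<open>The segment starts at \<open>y\<close> and runs towards \<open>?x\<close>, so it stays in the ball around \<open>?x\<close>.\<close>
    have near: "dist (y + t *\<^sub>R w) ?x < \<delta>" if t: "t \<in> {0..1}" for t
    proof -
      have "y + t *\<^sub>R w - ?x = (1 - t) *\<^sub>R (y - ?x)" by (simp add: w_def algebra_simps)
      then have "dist (y + t *\<^sub>R w) ?x = (1 - t) * dist y ?x" using t by (simp add: dist_norm)
      also have "\<dots> \<le> 1 * dist y ?x" using t by (intro mult_right_mono) auto
      finally show ?thesis using y(1) by simp
    qed
    have seg: "y + t *\<^sub>R w \<in> ?V" if "t \<in> {0..1}" for t
      using near[OF that] r(2) \<delta>(2) by (auto simp: dist_commute subset_iff)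
    have C1: "C1_curve_on M \<gamma> 0 1"
      unfolding \<gamma>_def by (rule C1_curve_on_chart_segment[OF M cc(1) seg])
    have "speed_within M g \<gamma> {0..1} t \<le> e/2" if t: "t \<in> {0..1}" for t
    proof -
      have ct: "c \<in> charts_at M (\<gamma> t)"
        using chart_inv_in[OF seg[OF t]] cc(1) by (simp add: charts_at_def \<gamma>_def)
      have "(snd c \<circ> \<gamma> has_vector_derivative w) (at t within {0..1})"
      proof (rule has_vector_derivative_transform[OF t])
        show "((\<lambda>t. y + t *\<^sub>R w) has_vector_derivative w) (at t within {0..1})"
          by (auto intro!: derivative_eq_intros)
        show "(snd c \<circ> \<gamma>) s = y + s *\<^sub>R w" if "s \<in> {0..1}" for s
          using chart_chart_inv[OF seg[OF that]] by (simp add: \<gamma>_def)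
      qed
      then have "velocity_within M \<gamma> {0..1} t = coord_vec M c (\<gamma> t) w"
        by (intro velocity_within_chart[OF M _ t C1_curve_onD(1)[OF C1] ct]) simp
      then have "speed_within M g \<gamma> {0..1} t = sqrt (chart_energy M g c (y + t *\<^sub>R w) w)"
        by (simp add: speed_within_def chart_energy_def Let_def \<gamma>_def)
      moreover have "dist (y + t *\<^sub>R w, w) (?x, 0) < d"
      proof -
        have "dist (y + t *\<^sub>R w, w) (?x, 0) \<le> dist (y + t *\<^sub>R w) ?x + dist w 0"
          by (simp add: dist_Pair_Pair sqrt_sum_squares_le_sum)
        also have "dist w 0 = dist y ?x" by (simp add: w_def dist_norm norm_minus_commute)
        finally show ?thesis using near[OF t] y(1) \<delta>(3) by simp
      qed
      then have "chart_energy M g c (y + t *\<^sub>R w) w \<le> (e/2)\<^sup>2"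
        using d(2)[of "(y + t *\<^sub>R w, w)"] Q(2) by (simp add: dist_real_def)
      then have "sqrt (chart_energy M g c (y + t *\<^sub>R w) w) \<le> sqrt ((e/2)\<^sup>2)"
        by (rule real_sqrt_le_mono)
      ultimately show ?thesis using e by simp
    qed
    then have "integral {0..1} (speed_within M g \<gamma> {0..1}) \<le> integral {0..1::real} (\<lambda>_. e/2)"
      by (intro integral_le integrable_continuous_real continuous_on_speed_within M g C1) auto
    then have "integral {0..1} (speed_within M g \<gamma> {0..1}) \<le> e/2" by simp
    then have "curve_length M g \<gamma> 0 1 < e"
      using integral_unique[OF speed_has_integral[OF M g _ C1]] e by (simp add: curve_length_def)
    moreover have "piecewise_C1_curve_on M \<gamma> 0 1"
      unfolding piecewise_C1_curve_on_def
      by (intro conjI exI[of _ 1] exI[of _ "\<lambda>k. real k"]) (use C1 in auto)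
    moreover have "\<gamma> 0 = q" "\<gamma> 1 = p"
      using chart_inv_chart[OF M cc(1)] y(2) cc(2) by (simp_all add: \<gamma>_def w_def y_def)
    ultimately show ?thesis unfolding riemannian_dist_less_iff by blast
  qed
  ultimately show ?thesis by blast
qed

lemma compactin_cluster_point:
  assumes K: "compactin X K" and \<sigma>: "\<And>n. n \<ge> N \<Longrightarrow> \<sigma> (n::nat) \<in> K"
  shows "\<exists>p\<in>K. \<forall>U m. openin X U \<longrightarrow> p \<in> U \<longrightarrow> (\<exists>n\<ge>m. \<sigma> n \<in> U)"
proof (rule ccontr)
  assume "\<not> ?thesis"
  then have "\<forall>p\<in>K. \<exists>U m. openin X U \<and> p \<in> U \<and> (\<forall>n\<ge>m. \<sigma> n \<notin> U)"
    by simp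
  then obtain U where "\<forall>p\<in>K. \<exists>m. openin X (U p) \<and> p \<in> U p \<and> (\<forall>n\<ge>m. \<sigma> n \<notin> U p)"
    by (rule bchoice[THEN exE])
  then obtain m where "\<forall>p\<in>K. openin X (U p) \<and> p \<in> U p \<and> (\<forall>n\<ge>m p. \<sigma> n \<notin> U p)"
    by (rule bchoice[THEN exE])
  then have U: "\<And>p. p \<in> K \<Longrightarrow> openin X (U p)" "\<And>p. p \<in> K \<Longrightarrow> p \<in> U p"
    "\<And>p n. p \<in> K \<Longrightarrow> n \<ge> m p \<Longrightarrow> \<sigma> n \<notin> U p"
    by blast+
  have "\<exists>\<F>. finite \<F> \<and> \<F> \<subseteq> U ` K \<and> K \<subseteq> \<Union>\<F>"
    by (rule compactinD[OF K]) (use U in auto)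
  then obtain F where F: "finite F" "F \<subseteq> K" "K \<subseteq> (\<Union>p\<in>F. U p)"
    by (auto dest: finite_subset_image)
  define n where "n = max N (Max (m ` F))"
  have "m p \<le> n" if "p \<in> F" for p
    using F(1) that by (simp add: n_def le_max_iff_disj)
  moreover have "\<sigma> n \<in> K" by (rule \<sigma>) (simp add: n_def)
  ultimately show False using F U(3) by blast
qed

text \<open>The completeness criterion. A Cauchy sequence has bounded \<^term>\<open>\<phi>\<close>-values, so it
  eventually stays in a compact set and has a cluster point in the manifold topology, which is then a
  limit for the distance.\<close>
lemma riemannian_complete_if_proper:
  assumes M: "smooth_manifold M" and g: "continuous_energy M g"
    and \<phi>: "\<And>p c. c \<in> charts_at M p \<Longrightarrow> (\<phi> \<circ> chart_inv c) differentiable (at (snd c p))"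
    and le: "\<And>p v. p \<in> points M \<Longrightarrow> v \<in> tangent_space M p \<Longrightarrow> (dfun M \<phi> p v)\<^sup>2 \<le> g p v v"
    and proper: "proper_map (mtop M) euclideanreal \<phi>"
  shows "riemannian_complete M g"
  unfolding riemannian_complete_def
proof (intro allI impI, elim conjE)
  fix \<sigma> :: "nat \<Rightarrow> 'a"
  assume \<sigma>: "range \<sigma> \<subseteq> points M"
    and cauchy: "\<forall>e>0. \<exists>N. \<forall>m\<ge>N. \<forall>n\<ge>N. riemannian_dist M g (\<sigma> m) (\<sigma> n) < ereal e"
  have incr: "ereal \<bar>\<phi> q - \<phi> p\<bar> \<le> riemannian_dist M g p q" for p q
    by (rule increment_le_riemannian_dist[OF M g]) (rule \<phi>, assumption, rule le, assumption+)
  obtain N where N: "\<And>m n. m \<ge> N \<Longrightarrow> n \<ge> N \<Longrightarrow> riemannian_dist M g (\<sigma> m) (\<sigma> n) < ereal 1"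
    using cauchy[rule_format, OF zero_less_one] by blast
  define K where "K = {x \<in> points M. \<phi> x \<in> {\<phi> (\<sigma> N) - 1..\<phi> (\<sigma> N) + 1}}"
  have K: "compactin (mtop M) K"
    unfolding K_def by (rule compactin_proper_map_preimage[OF proper]) simp
  have "\<sigma> n \<in> K" if "n \<ge> N" for n
  proof -
    have "ereal \<bar>\<phi> (\<sigma> n) - \<phi> (\<sigma> N)\<bar> < ereal 1"
      by (rule le_less_trans[OF incr N[OF order_refl that]])
    then show ?thesis using \<sigma> by (auto simp: K_def)
  qed
  then obtain p where p: "p \<in> K"
    and clus: "\<And>U m. openin (mtop M) U \<Longrightarrow> p \<in> U \<Longrightarrow> \<exists>n\<ge>m. \<sigma> n \<in> U"
    using compactin_cluster_point[OF K, of N \<sigma>] by auto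
  have pM: "p \<in> points M" using p by (simp add: K_def)
  \<comment> \<open>One late member of the sequence close to the cluster point controls all later ones.\<close>
  have lim: "\<exists>N. \<forall>n\<ge>N. riemannian_dist M g (\<sigma> n) p < ereal e" if e: "e > 0" for e
  proof -
    obtain N where N: "\<And>m n. m \<ge> N \<Longrightarrow> n \<ge> N \<Longrightarrow> riemannian_dist M g (\<sigma> m) (\<sigma> n) < ereal (e/2)"
      using cauchy[rule_format, OF half_gt_zero[OF e]] by blast
    obtain U where U: "openin (mtop M) U" "p \<in> U" "\<And>q. q \<in> U \<Longrightarrow> riemannian_dist M g q p < ereal (e/2)"
      using riemannian_dist_small_nbhd[OF M g pM half_gt_zero[OF e]] by blast
    obtain k where k: "k \<ge> N" "\<sigma> k \<in> U" using clus[OF U(1,2)] by blast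
    have "riemannian_dist M g (\<sigma> n) p < ereal (e/2 + e/2)" if "n \<ge> N" for n
      by (rule riemannian_dist_triangle[OF M g N[OF that k(1)] U(3)[OF k(2)]])
    then show ?thesis by (intro exI[of _ N]) simp
  qed
  have "(\<lambda>n. riemannian_dist M g (\<sigma> n) p) \<longlonglongrightarrow> 0"
  proof (rule order_tendstoI)
    fix a :: ereal assume "a < 0"
    moreover have "0 \<le> riemannian_dist M g (\<sigma> n) p" for n
      using incr[of p "\<sigma> n"] by (rule order_trans[rotated]) (simp add: zero_ereal_def)
    ultimately show "\<forall>\<^sub>F n in sequentially. a < riemannian_dist M g (\<sigma> n) p"
      by (intro always_eventually allI) (rule less_le_trans)
  next
    fix a :: ereal assume "0 < a"
    from ereal_dense2[OF this] obtain e where e: "0 < ereal e" "ereal e < a" by (elim exE conjE)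
    then obtain N where N: "\<forall>n\<ge>N. riemannian_dist M g (\<sigma> n) p < ereal e" using lim[of e] by auto
    show "\<forall>\<^sub>F n in sequentially. riemannian_dist M g (\<sigma> n) p < a"
      by (rule eventually_mono[OF eventually_ge_at_top[of N]]) (use N e(2) less_trans in blast)
  qed
  then show "\<exists>p\<in>points M. (\<lambda>n. riemannian_dist M g (\<sigma> n) p) \<longlonglongrightarrow> 0" using pM by blast
qed


section \<open>Riemannian metrics\<close>

lemma continuous_on_derivative_pair:
  fixes F :: "'m::euclidean_space \<Rightarrow> 'b::real_normed_vector"
  assumes F: "smooth_on S F"
  shows "continuous_on (S \<times> UNIV) (\<lambda>(z, x). frechet_derivative F (at z) x)"
proof -
  have "frechet_derivative F (at z) x = (\<Sum>i\<in>Basis. (x \<bullet> i) *\<^sub>R frechet_derivative F (at z) i)"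
    if "z \<in> S" for z x
  proof -
    have lin: "linear (frechet_derivative F (at z))"
      by (rule linear_frechet_derivative[OF smooth_on_differentiable[OF F that]])
    have "frechet_derivative F (at z) (\<Sum>i\<in>Basis. (x \<bullet> i) *\<^sub>R i) =
        (\<Sum>i\<in>Basis. (x \<bullet> i) *\<^sub>R frechet_derivative F (at z) i)"
      by (simp add: linear_sum[OF lin] linear_scale[OF lin])
    then show ?thesis by (simp add: euclidean_representation)
  qed
  moreover have "continuous_on (S \<times> UNIV)
      (\<lambda>q. \<Sum>i\<in>Basis. (snd q \<bullet> i) *\<^sub>R frechet_derivative F (at (fst q)) i)"
  proof (intro continuous_intros)
    fix i :: 'm
    show "continuous_on (S \<times> UNIV) (\<lambda>q. frechet_derivative F (at (fst q)) i)"
      by (rule continuous_on_compose2[OF smooth_on_derivative_continuous_on[OF F]])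
        (auto intro!: continuous_intros)
  qed
  ultimately show ?thesis
    by (elim continuous_on_eq) auto
qed

lemma riemannian_metricD:
  assumes g: "riemannian_metric L g" and p: "p \<in> points L"
    and uvw: "u \<in> tangent_space L p" "v \<in> tangent_space L p" "w \<in> tangent_space L p"
  shows riemannian_metric_sym: "g p u v = g p v u"
    and riemannian_metric_linear: "g p (\<lambda>c. a *\<^sub>R u c + b *\<^sub>R v c) w = a * g p u w + b * g p v w"
    and riemannian_metric_pos: "u \<noteq> (\<lambda>_. 0) \<Longrightarrow> g p u u > 0"
  using g p uvw unfolding riemannian_metric_def by blast+

lemma riemannian_metric_zero:
  assumes L: "smooth_manifold L" and g: "riemannian_metric L g" and p: "p \<in> points L"
    and w: "w \<in> tangent_space L p"
  shows "g p (\<lambda>_. 0) w = 0"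
  using riemannian_metric_linear[OF g p w w w, of 0 0] by simp

lemma riemannian_metric_nonneg:
  assumes L: "smooth_manifold L" and g: "riemannian_metric L g" and p: "p \<in> points L"
    and w: "w \<in> tangent_space L p"
  shows "g p w w \<ge> 0"
proof (cases "w = (\<lambda>_. 0)")
  case True
  then show ?thesis using riemannian_metric_zero[OF assms] by simp
next
  case False
  then show ?thesis using riemannian_metric_pos[OF g p w w w] by simp
qed

lemma tangent_space_combination:
  assumes L: "smooth_manifold L" and p: "p \<in> points L"
    and u: "u \<in> tangent_space L p" and v: "v \<in> tangent_space L p"
  shows "(\<lambda>c. a *\<^sub>R u c + b *\<^sub>R v c) \<in> tangent_space L p"
proof -
  obtain c where c: "c \<in> charts_at L p" using ex_chart[OF L p] ..
  have "coord_vec L c p (a *\<^sub>R u c + b *\<^sub>R v c) = (\<lambda>c. a *\<^sub>R u c + b *\<^sub>R v c)"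
    by (simp only: coord_vec_linear[OF L c] coord_vec_tangent[OF L u c] coord_vec_tangent[OF L v c])
  then show ?thesis using coord_vec_in_tangent_space[OF L c] by metis
qed

text \<open>Evaluate the metric on \<open>g(v, v) u - g(u, v) v\<close>.\<close>
lemma riemannian_metric_Cauchy_Schwarz:
  assumes L: "smooth_manifold L" and g: "riemannian_metric L g" and p: "p \<in> points L"
    and u: "u \<in> tangent_space L p" and v: "v \<in> tangent_space L p"
  shows "(g p u v)\<^sup>2 \<le> g p u u * g p v v"
proof (cases "v = (\<lambda>_. 0)")
  case True
  then show ?thesis
    using riemannian_metric_zero[OF L g p u] riemannian_metric_zero[OF L g p v]
      riemannian_metric_sym[OF g p u v v] by simp
next
  case False
  let ?a = "g p v v" and ?b = "g p u v"
  let ?w = "\<lambda>c. ?a *\<^sub>R u c + (- ?b) *\<^sub>R v c"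
  have w: "?w \<in> tangent_space L p" by (rule tangent_space_combination[OF L p u v])
  have a: "?a > 0" by (rule riemannian_metric_pos[OF g p v v v False])
  have "g p ?w ?w = ?a * g p u ?w + - ?b * g p v ?w"
    by (rule riemannian_metric_linear[OF g p u v w])
  also have "g p u ?w = g p ?w u" by (rule riemannian_metric_sym[OF g p u w w])
  also have "\<dots> = ?a * g p u u + - ?b * g p v u" by (rule riemannian_metric_linear[OF g p u v u])
  also have "g p v ?w = g p ?w v" by (rule riemannian_metric_sym[OF g p v w w])
  also have "\<dots> = ?a * ?b + - ?b * ?a" by (rule riemannian_metric_linear[OF g p u v v])
  also have "g p v u = ?b" by (rule riemannian_metric_sym[OF g p v u u])
  finally have "g p ?w ?w = ?a * (g p u u * ?a - ?b\<^sup>2)"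
    by (simp add: algebra_simps power2_eq_square)
  with riemannian_metric_nonneg[OF L g p w] a show ?thesis
    by (simp add: zero_le_mult_iff)
qed

text \<open>By bilinearity the energy is a quadratic polynomial in the coordinates of the vector, with
  the smooth metric coefficients as coefficients.\<close>
lemma continuous_energy_riemannian:
  assumes L: "smooth_manifold L" and g: "riemannian_metric L g"
  shows "continuous_energy L g"
  unfolding continuous_energy_def
proof (intro ballI conjI)
  fix c assume c: "c \<in> atlas L"
  let ?V = "snd c ` fst c"
  define B where "B z x y = (let p = chart_inv c z in g p (coord_vec L c p x) (coord_vec L c p y))" for z x y
  have chart: "c \<in> charts_at L (chart_inv c z)" "chart_inv c z \<in> points L" if "z \<in> ?V" for z
    using chart_inv_in[OF that] c chart_domain_subset[OF L c] by (auto simp: charts_at_def)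
  have bil: "bilinear (B z)" if z: "z \<in> ?V" for z
  proof -
    note T = coord_vec_in_tangent_space[OF L chart(1)[OF z]]
    have sym: "B z x y = B z y x" for x y
      unfolding B_def Let_def by (rule riemannian_metric_sym[OF g chart(2)[OF z] T T T])
    have lin: "B z (a *\<^sub>R x + b *\<^sub>R x') y = a * B z x y + b * B z x' y" for a b x x' y
      unfolding B_def Let_def coord_vec_linear[OF L chart(1)[OF z]]
      by (rule riemannian_metric_linear[OF g chart(2)[OF z] T T T])
    have left: "linear (\<lambda>x. B z x y)" for y
      using lin[of 1 _ 1] lin[of _ _ 0] by (intro linearI) simp_all
    have eq: "B z x = (\<lambda>y. B z y x)" for x by (rule ext) (rule sym)
    have "linear (B z x)" for x by (rule ssubst[OF eq]) (rule left)
    with left show ?thesis by (simp add: bilinear_def)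
  qed
  have E: "chart_energy L g c z x = B z x x" for z x
    by (simp add: chart_energy_def B_def Let_def)
  have "chart_energy L g c z x = (\<Sum>i\<in>Basis. \<Sum>j\<in>Basis. (x \<bullet> j) * (x \<bullet> i) * B z i j)" if z: "z \<in> ?V" for z x
  proof -
    have "B z x x = B z (\<Sum>i\<in>Basis. (x \<bullet> i) *\<^sub>R i) (\<Sum>i\<in>Basis. (x \<bullet> i) *\<^sub>R i)"
      by (simp add: euclidean_representation)
    also have "\<dots> = (\<Sum>(i, j)\<in>Basis \<times> Basis. B z ((x \<bullet> i) *\<^sub>R i) ((x \<bullet> j) *\<^sub>R j))"
      by (rule bilinear_sum[OF bil[OF z]])
    also have "\<dots> = (\<Sum>i\<in>Basis. \<Sum>j\<in>Basis. (x \<bullet> j) * (x \<bullet> i) * B z i j)"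
      by (simp add: sum.cartesian_product bilinear_lmul[OF bil[OF z]] bilinear_rmul[OF bil[OF z]] mult.assoc)
    finally show ?thesis by (simp add: E)
  qed
  moreover have "continuous_on (?V \<times> UNIV)
     (\<lambda>q. \<Sum>i\<in>Basis. \<Sum>j\<in>Basis. (snd q \<bullet> j) * (snd q \<bullet> i) * B (fst q) i j)"
  proof (intro continuous_intros)
    fix i j
    have "smooth_on ?V (\<lambda>z. B z i j)"
      unfolding B_def
      using bspec[OF conjunct2[OF g[unfolded riemannian_metric_def]] c] by (elim allE)
    from smooth_on_continuous_on[OF this]
    show "continuous_on (?V \<times> UNIV) (\<lambda>q. B (fst q) i j)"
      by (rule continuous_on_compose2) (auto intro!: continuous_intros)
  qed
  ultimately show "continuous_on (?V \<times> UNIV) (\<lambda>(z, x). chart_energy L g c z x)"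
    by (elim continuous_on_eq) auto
  show "chart_energy L g c z 0 = 0" if "z \<in> ?V" for z
    using bilinear_lzero[OF bil[OF that]] by (simp add: E)
qed


section \<open>Generalized Robertson-Walker spaces\<close>

text \<open>The chart of the space \<open>I \<times>\<^sub>f L\<close> induced by a chart of the fibre \<^term>\<open>L\<close>.\<close>
definition grw_chart :: "real set \<Rightarrow> ('a, 'e) chart \<Rightarrow> (real \<times> 'a, real \<times> 'e) chart" where
  "grw_chart I e = (I \<times> fst e, map_prod id (snd e))"

lemma atlas_grw: "atlas (grw_manifold I L) = grw_chart I ` atlas L"
proof (intro equalityI subsetI)
  fix x assume "x \<in> atlas (grw_manifold I L)"
  then show "x \<in> grw_chart I ` atlas L"
    by (auto simp: grw_manifold_def product_manifold_def interval_manifold_def grw_chart_def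
        intro: rev_image_eqI)
next
  fix x assume "x \<in> grw_chart I ` atlas L"
  then obtain d where d: "d \<in> atlas L" "x = grw_chart I d" by (rule imageE)
  show "x \<in> atlas (grw_manifold I L)"
    unfolding grw_manifold_def product_manifold_def interval_manifold_def manifold.simps mem_Collect_eq
    by (intro exI[of _ "(I, id)"] exI[of _ d]) (simp add: d grw_chart_def)
qed

lemma mtop_grw: "mtop (grw_manifold I L) = prod_topology (top_of_set I) (mtop L)"
  by (simp add: grw_manifold_def product_manifold_def interval_manifold_def)

lemma points_grw: "points (grw_manifold I L) = I \<times> points L"
  by (simp add: mtop_grw)

lemma charts_at_grw:
  assumes "fst p \<in> I"
  shows "charts_at (grw_manifold I L) p = grw_chart I ` charts_at L (snd p)"
  using assms by (cases p) (auto simp: charts_at_def atlas_grw grw_chart_def)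

lemma chart_inv_grw:
  assumes L: "smooth_manifold L" and e: "e \<in> atlas L" and t: "t \<in> I" and y: "y \<in> snd e ` fst e"
  shows "chart_inv (grw_chart I e) (t, y) = (t, chart_inv e y)"
proof -
  have "inj_on (map_prod id (snd e)) (I \<times> fst e)"
    by (intro map_prod_inj_on inj_on_id inj_on_chart[OF L e])
  moreover have "(t, chart_inv e y) \<in> I \<times> fst e" using t chart_inv_in[OF y] by simp
  ultimately have "chart_inv (grw_chart I e) (map_prod id (snd e) (t, chart_inv e y)) = (t, chart_inv e y)"
    unfolding chart_inv_def grw_chart_def fst_conv snd_conv by (rule inv_into_f_f)
  then show ?thesis by (simp add: chart_chart_inv[OF y])
qed

text \<open>The chart \<^term>\<open>e\<close> is the fibre part of the product chart that the choice operator in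
  \<^const>\<open>dfun\<close> selects; in it both projections are linear.\<close>
lemma grw_projections:
  fixes L :: "('a, 'e::euclidean_space) manifold"
  assumes I: "open I" and L: "smooth_manifold L" and p: "fst p \<in> I" "snd p \<in> points L"
  shows "\<exists>e\<in>charts_at L (snd p). \<forall>w.
     dfun (grw_manifold I L) fst p w = fst (w (grw_chart I e)) \<and>
     differential (grw_manifold I L) L snd p w = coord_vec L e (snd p) (snd (w (grw_chart I e)))"
proof -
  let ?N = "grw_manifold I L"
  obtain e0 where e0: "e0 \<in> charts_at L (snd p)" using ex_chart[OF L p(2)] ..
  have "(SOME c. c \<in> charts_at ?N p) \<in> charts_at ?N p"
    by (rule someI[of _ "grw_chart I e0"]) (simp add: charts_at_grw[OF p(1)] e0)
  then obtain e where e: "e \<in> charts_at L (snd p)"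
    and some: "(SOME c. c \<in> charts_at ?N p) = grw_chart I e"
    by (auto simp: charts_at_grw[OF p(1)])
  note ee = charts_atD[OF e]
  let ?V = "snd e ` fst e"
  have V: "open (I \<times> ?V)" by (rule open_Times[OF I open_chart_image[OF L ee(1)]])
  have img: "snd (grw_chart I e) p = (fst p, snd e (snd p))"
    by (cases p) (simp add: grw_chart_def)
  have pV: "(fst p, snd e (snd p)) \<in> I \<times> ?V" using p(1) ee(2) by simp
  have "((fst \<circ> chart_inv (grw_chart I e)) has_derivative fst) (at (fst p, snd e (snd p)))"
    by (rule has_derivative_transform_within_open[OF has_derivative_fst[OF has_derivative_ident] V pV])
      (auto simp: chart_inv_grw[OF L ee(1)])
  from frechet_derivative_at[OF this, symmetric]
  have fst: "dfun ?N fst p w = fst (w (grw_chart I e))" for w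
    by (simp only: dfun_def some Let_def img)
  have snd: "differential ?N L snd p w = coord_vec L e (snd p) (snd (w (grw_chart I e)))" for w
  proof
    fix d
    show "differential ?N L snd p w d = coord_vec L e (snd p) (snd (w (grw_chart I e))) d"
    proof (cases "d \<in> charts_at L (snd p)")
      case d: True
      have T: "((snd d \<circ> chart_inv e) has_derivative
          frechet_derivative (snd d \<circ> chart_inv e) (at (snd e (snd p))))
          (at (snd (fst p, snd e (snd p))))"
        using iffD1[OF frechet_derivative_works transition_differentiable[OF L e d]] by simp
      have "((snd d \<circ> snd \<circ> chart_inv (grw_chart I e)) has_derivative
         (\<lambda>x. frechet_derivative (snd d \<circ> chart_inv e) (at (snd e (snd p))) (snd x)))
         (at (fst p, snd e (snd p)))"
        by (rule has_derivative_transform_within_open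
              [OF has_derivative_compose[OF has_derivative_snd[OF has_derivative_ident] T] V pV])
          (auto simp: chart_inv_grw[OF L ee(1)])
      from fun_cong[OF frechet_derivative_at[OF this, symmetric]] show ?thesis
        using d by (simp only: differential_def coord_vec_def dfun_def some Let_def img if_True)
    qed (simp add: differential_def coord_vec_def)
  qed
  show ?thesis by (intro bexI[OF _ e] allI conjI fst snd)
qed

lemma grw_metric_eq:
  "grw_metric I f L g0 p u v =
     - (dfun (grw_manifold I L) fst p u * dfun (grw_manifold I L) fst p v) +
     (f (fst p))\<^sup>2 * g0 (snd p) (differential (grw_manifold I L) L snd p u)
        (differential (grw_manifold I L) L snd p v)"
  by (simp add: grw_metric_def pullback_def)

lemma grw_dt_projections:
  fixes L :: "('a, 'e::euclidean_space) manifold"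
  assumes I: "open I" and L: "smooth_manifold L" and p: "fst p \<in> I" "snd p \<in> points L"
  shows "dfun (grw_manifold I L) fst p (\<lambda>c. a *\<^sub>R grw_dt I L p c) = a"
    and "differential (grw_manifold I L) L snd p (\<lambda>c. a *\<^sub>R grw_dt I L p c) = (\<lambda>_. 0)"
proof -
  obtain e where e: "e \<in> charts_at L (snd p)"
    and proj: "\<forall>w. dfun (grw_manifold I L) fst p w = fst (w (grw_chart I e)) \<and>
     differential (grw_manifold I L) L snd p w = coord_vec L e (snd p) (snd (w (grw_chart I e)))"
    using grw_projections[OF I L p] by (rule bexE)
  have "((\<lambda>s. (s, snd e (snd p))) has_vector_derivative (1, 0)) (at (fst p))"
    by (intro has_vector_derivative_Pair derivative_intros)
  moreover have "snd (grw_chart I e) \<circ> (\<lambda>s. (s, snd p)) = (\<lambda>s. (s, snd e (snd p)))"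
    by (auto simp: grw_chart_def)
  moreover have "grw_chart I e \<in> charts_at (grw_manifold I L) (fst p, snd p)"
    using charts_at_grw[of "(fst p, snd p)" I L] p(1) e by simp
  ultimately have "grw_dt I L p (grw_chart I e) = (1, 0)"
    by (simp add: grw_dt_def velocity_def vector_derivative_at)
  then show "dfun (grw_manifold I L) fst p (\<lambda>c. a *\<^sub>R grw_dt I L p c) = a"
    and "differential (grw_manifold I L) L snd p (\<lambda>c. a *\<^sub>R grw_dt I L p c) = (\<lambda>_. 0)"
    by (simp_all only: proj[rule_format] scaleR_Pair fst_conv snd_conv scaleR_zero_right
        coord_vec_zero[OF L e]) simp
qed


section \<open>Null hypersurfaces and the rigged metric\<close>

text \<open>Throughout, a tangent vector \<open>v\<close> of a submanifold of \<open>I \<times>\<^sub>f L\<close> is decomposed into its time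
  component \<^term>\<open>dfun M fst p v\<close> and its space component \<^term>\<open>differential M L snd p v\<close>.\<close>
context
  fixes I :: "real set" and L :: "('a, 'e::euclidean_space) manifold" and g0 :: "('a, 'e) tensor2"
    and M :: "(real \<times> 'a, 'm::euclidean_space) manifold"
  assumes I: "open I" and L: "smooth_manifold L" and g0: "riemannian_metric L g0"
    and sub: "submanifold M (grw_manifold I L)"
begin

lemma smooth_manifold_sub: "smooth_manifold M"
  using sub by (simp add: submanifold_def)

lemma points_sub:
  assumes "p \<in> points M" shows "fst p \<in> I" "snd p \<in> points L"
proof -
  have "points M \<subseteq> points (grw_manifold I L)" using sub by (simp add: submanifold_def)
  from subsetD[OF this assms, unfolded points_grw]
  show "fst p \<in> I" "snd p \<in> points L" by (simp_all add: mem_Times_iff)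
qed

lemma points_subI: "c \<in> charts_at M p \<Longrightarrow> p \<in> points M"
  by (rule subsetD[OF chart_domain_subset[OF smooth_manifold_sub charts_atD(1)] charts_atD(2)])

text \<open>\<^term>\<open>map_prod id (snd e) \<circ> chart_inv c\<close> is the inclusion in coordinates. Its domain needs no
  condition on the time coordinate, which lies in \<^term>\<open>I\<close> on all of \<^term>\<open>M\<close>.\<close>
lemma smooth_on_local_rep:
  assumes c: "c \<in> atlas M" and e: "e \<in> atlas L"
  shows "smooth_on (snd c ` {p \<in> fst c. snd p \<in> fst e}) (map_prod id (snd e) \<circ> chart_inv c)"
proof -
  have "smooth_on (snd c ` (fst c \<inter> id -` fst (grw_chart I e)))
      (snd (grw_chart I e) \<circ> id \<circ> chart_inv c)"
    using sub c imageI[OF e, of "grw_chart I"]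
    unfolding submanifold_def smooth_map_def atlas_grw by blast
  moreover have "p \<in> fst c \<inter> id -` fst (grw_chart I e) \<longleftrightarrow> p \<in> fst c \<and> snd p \<in> fst e" for p
    using points_sub(1)[of p] subsetD[OF chart_domain_subset[OF smooth_manifold_sub c], of p]
    by (cases p) (auto simp: grw_chart_def)
  then have "fst c \<inter> id -` fst (grw_chart I e) = {p \<in> fst c. snd p \<in> fst e}" by blast
  ultimately show ?thesis by (simp add: grw_chart_def)
qed

lemma open_local_rep_domain:
  assumes c: "c \<in> atlas M" and e: "e \<in> atlas L"
  shows "open (snd c ` {p \<in> fst c. snd p \<in> fst e})"
proof -
  have "continuous_map (mtop M) (mtop (grw_manifold I L)) id"
    using sub by (simp add: submanifold_def smooth_map_def)
  from continuous_map_compose[OF this[unfolded mtop_grw] continuous_map_snd]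
  have "continuous_map (mtop M) (mtop L) snd" by simp
  then have "openin (mtop M) {p \<in> points M. snd p \<in> fst e}"
    by (rule openin_continuous_map_preimage[OF _ openin_chart_domain[OF L e]])
  from open_chart_image_Int[OF smooth_manifold_sub c this]
  moreover have "fst c \<inter> {p \<in> points M. snd p \<in> fst e} = {p \<in> fst c. snd p \<in> fst e}"
    using chart_domain_subset[OF smooth_manifold_sub c] by blast
  ultimately show ?thesis by simp
qed

lemma
  assumes c: "c \<in> charts_at M p" and e: "e \<in> charts_at L (snd p)"
  shows local_rep_has_derivative: "((map_prod id (snd e) \<circ> chart_inv c) has_derivative
      frechet_derivative (map_prod id (snd e) \<circ> chart_inv c) (at (snd c p))) (at (snd c p))"
    and time_has_derivative: "((fst \<circ> chart_inv c) has_derivative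
      (\<lambda>x. fst (frechet_derivative (map_prod id (snd e) \<circ> chart_inv c) (at (snd c p)) x))) (at (snd c p))"
    and space_has_derivative: "((snd e \<circ> snd \<circ> chart_inv c) has_derivative
      (\<lambda>x. snd (frechet_derivative (map_prod id (snd e) \<circ> chart_inv c) (at (snd c p)) x))) (at (snd c p))"
proof -
  show D: "((map_prod id (snd e) \<circ> chart_inv c) has_derivative
      frechet_derivative (map_prod id (snd e) \<circ> chart_inv c) (at (snd c p))) (at (snd c p))"
    by (rule iffD1[OF frechet_derivative_works], rule smooth_on_differentiable[OF smooth_on_local_rep])
      (use charts_atD[OF c] charts_atD[OF e] in auto)
  show "((fst \<circ> chart_inv c) has_derivative
      (\<lambda>x. fst (frechet_derivative (map_prod id (snd e) \<circ> chart_inv c) (at (snd c p)) x))) (at (snd c p))"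
    using has_derivative_fst[OF D] by (simp add: o_def)
  show "((snd e \<circ> snd \<circ> chart_inv c) has_derivative
      (\<lambda>x. snd (frechet_derivative (map_prod id (snd e) \<circ> chart_inv c) (at (snd c p)) x))) (at (snd c p))"
    using has_derivative_snd[OF D] by (simp add: o_def)
qed

lemma ex_space_chart:
  assumes "c \<in> charts_at M p" obtains e where "e \<in> charts_at L (snd p)"
  using ex_chart[OF L points_sub(2)[OF points_subI[OF assms]]] by blast

lemma dfun_time_eq:
  assumes v: "v \<in> tangent_space M p" and c: "c \<in> charts_at M p" and e: "e \<in> charts_at L (snd p)"
  shows "dfun M fst p v = fst (frechet_derivative (map_prod id (snd e) \<circ> chart_inv c) (at (snd c p)) (v c))"
proof -
  have "dfun M fst p v = frechet_derivative (fst \<circ> chart_inv c) (at (snd c p)) (v c)"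
    using time_has_derivative[OF _ e] by (intro dfun_eq[OF smooth_manifold_sub c v]) (rule differentiableI)
  then show ?thesis
    using fun_cong[OF frechet_derivative_at[OF time_has_derivative[OF c e]], of "v c"] by simp
qed

lemma differential_space_eq:
  assumes v: "v \<in> tangent_space M p" and c: "c \<in> charts_at M p" and e: "e \<in> charts_at L (snd p)"
  shows "differential M L snd p v = coord_vec L e (snd p)
     (snd (frechet_derivative (map_prod id (snd e) \<circ> chart_inv c) (at (snd c p)) (v c)))"
proof
  fix d
  let ?R = "frechet_derivative (map_prod id (snd e) \<circ> chart_inv c) (at (snd c p))"
  show "differential M L snd p v d = coord_vec L e (snd p) (snd (?R (v c))) d"
  proof (cases "d \<in> charts_at L (snd p)")
    case d: True
    note ce = charts_atD[OF c] charts_atD[OF e]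
    have "dfun M (snd d \<circ> snd) p v = frechet_derivative (snd d \<circ> snd \<circ> chart_inv c) (at (snd c p)) (v c)"
      using space_has_derivative[OF _ d] by (intro dfun_eq[OF smooth_manifold_sub c v]) (rule differentiableI)
    moreover have "((snd d \<circ> snd \<circ> chart_inv c) has_derivative
        (\<lambda>x. frechet_derivative (snd d \<circ> chart_inv e) (at (snd e (snd p))) (snd (?R x)))) (at (snd c p))"
    proof -
      have T: "((snd d \<circ> chart_inv e) has_derivative
          frechet_derivative (snd d \<circ> chart_inv e) (at (snd e (snd p))))
          (at ((snd e \<circ> snd \<circ> chart_inv c) (snd c p)))"
        using iffD1[OF frechet_derivative_works transition_differentiable[OF L e d]]
        by (simp add: chart_inv_chart[OF smooth_manifold_sub ce(1,2)])
      show ?thesis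
        by (rule has_derivative_transform_within_open
              [OF has_derivative_compose[OF space_has_derivative[OF c e] T]
                open_local_rep_domain[OF ce(1,3)]])
          (use ce chart_inv_chart[OF smooth_manifold_sub ce(1)] chart_inv_chart[OF L ce(3)] in auto)
    qed
    from fun_cong[OF frechet_derivative_at[OF this], of "v c"]
    have "frechet_derivative (snd d \<circ> snd \<circ> chart_inv c) (at (snd c p)) (v c) =
       frechet_derivative (snd d \<circ> chart_inv e) (at (snd e (snd p))) (snd (?R (v c)))" by (rule sym)
    ultimately show ?thesis using d by (simp add: differential_def coord_vec_def)
  qed (simp add: differential_def coord_vec_def)
qed

lemma differential_space_tangent:
  assumes p: "p \<in> points M" and v: "v \<in> tangent_space M p"
  shows "differential M L snd p v \<in> tangent_space L (snd p)"
proof -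
  obtain c where c: "c \<in> charts_at M p" using ex_chart[OF smooth_manifold_sub p] ..
  obtain e where e: "e \<in> charts_at L (snd p)" using ex_space_chart[OF c] .
  show ?thesis
    unfolding differential_space_eq[OF v c e] by (rule coord_vec_in_tangent_space[OF L e])
qed

lemma differential_inclusion_eq:
  assumes v: "v \<in> tangent_space M p" and c: "c \<in> charts_at M p" and e: "e \<in> charts_at L (snd p)"
  shows "differential M (grw_manifold I L) id p v (grw_chart I e) =
     frechet_derivative (map_prod id (snd e) \<circ> chart_inv c) (at (snd c p)) (v c)"
proof -
  have "grw_chart I e \<in> charts_at (grw_manifold I L) (id p)"
    using charts_at_grw[OF points_sub(1)[OF points_subI[OF c]], of L] e by (simp add: imageI)
  moreover have "dfun M (map_prod id (snd e)) p v =
      frechet_derivative (map_prod id (snd e) \<circ> chart_inv c) (at (snd c p)) (v c)"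
    using local_rep_has_derivative[OF _ e] by (intro dfun_eq[OF smooth_manifold_sub c v]) (rule differentiableI)
  ultimately show ?thesis by (simp add: differential_def grw_chart_def)
qed

text \<open>The components of a vector computed on the submanifold agree with those of its image in the
  ambient space.\<close>
lemma
  assumes p: "p \<in> points M" and v: "v \<in> tangent_space M p"
  shows dfun_time_inclusion:
      "dfun (grw_manifold I L) fst p (differential M (grw_manifold I L) id p v) = dfun M fst p v"
    and differential_space_inclusion:
      "differential (grw_manifold I L) L snd p (differential M (grw_manifold I L) id p v) =
        differential M L snd p v"
proof -
  obtain c where c: "c \<in> charts_at M p" using ex_chart[OF smooth_manifold_sub p] ..
  obtain e where e: "e \<in> charts_at L (snd p)"
    and proj: "\<forall>w. dfun (grw_manifold I L) fst p w = fst (w (grw_chart I e)) \<and>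
     differential (grw_manifold I L) L snd p w = coord_vec L e (snd p) (snd (w (grw_chart I e)))"
    using grw_projections[OF I L points_sub[OF p]] by (rule bexE)
  show "dfun (grw_manifold I L) fst p (differential M (grw_manifold I L) id p v) = dfun M fst p v"
    "differential (grw_manifold I L) L snd p (differential M (grw_manifold I L) id p v) =
        differential M L snd p v"
    by (simp_all only: proj differential_inclusion_eq[OF v c e] dfun_time_eq[OF v c e]
        differential_space_eq[OF v c e])
qed

text \<open>The inclusion is an immersion, so a vector is determined by its two components.\<close>
lemma inclusion_differential_zero:
  assumes p: "p \<in> points M" and v: "v \<in> tangent_space M p"
    and "dfun M fst p v = 0" and "differential M L snd p v = (\<lambda>_. 0)"
  shows "v = (\<lambda>_. 0)"
proof -
  obtain c where c: "c \<in> charts_at M p" using ex_chart[OF smooth_manifold_sub p] ..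
  note z = zero_in_tangent_space[OF smooth_manifold_sub p]
  have "differential M (grw_manifold I L) id p v d = differential M (grw_manifold I L) id p (\<lambda>_. 0) d" for d
  proof (cases "d \<in> charts_at (grw_manifold I L) p")
    case True
    then have "d \<in> grw_chart I ` charts_at L (snd p)"
      by (simp only: charts_at_grw[OF points_sub(1)[OF p]])
    then obtain e where d: "d = grw_chart I e" and e: "e \<in> charts_at L (snd p)" by (rule imageE)
    let ?R = "frechet_derivative (map_prod id (snd e) \<circ> chart_inv c) (at (snd c p))"
    have "fst (?R (v c)) = 0" using assms(3) dfun_time_eq[OF v c e] by simp
    moreover have "snd (?R (v c)) = 0"
      using assms(4) fun_cong[OF differential_space_eq[OF v c e], of e] coord_vec_same[OF L e] by simp
    ultimately have "?R (v c) = 0" by (simp add: prod_eq_iff)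
    moreover have "?R 0 = 0"
      by (rule linear_0[OF has_derivative_linear[OF local_rep_has_derivative[OF c e]]])
    ultimately show ?thesis
      unfolding d differential_inclusion_eq[OF v c e] differential_inclusion_eq[OF z c e] by simp
  qed (simp add: differential_def)
  then have eq: "differential M (grw_manifold I L) id p v = differential M (grw_manifold I L) id p (\<lambda>_. 0)"
    by (rule ext)
  have "inj_on (differential M (grw_manifold I L) id p) (tangent_space M p)"
    using sub p by (simp add: submanifold_def)
  from inj_onD[OF this eq v z] show ?thesis .
qed

text \<open>Since \<open>\<alpha>(v) = - f dt(v)\<close>, the rigged metric adds \<open>f\<^sup>2 dt(v)\<^sup>2\<close> to the Lorentzian square
  \<open>- dt(v)\<^sup>2 + f\<^sup>2 g\<^sub>0(v, v)\<close>.\<close>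
lemma rigged_metric_eq:
  assumes p: "p \<in> points M" and v: "v \<in> tangent_space M p"
  shows "rigged_metric M (grw_manifold I L) (grw_metric I f L g0)
      (\<lambda>p c. f (fst p) *\<^sub>R grw_dt I L p c) p v v =
     (f (fst p))\<^sup>2 * g0 (snd p) (differential M L snd p v) (differential M L snd p v) +
     ((f (fst p))\<^sup>2 - 1) * (dfun M fst p v)\<^sup>2"
proof -
  note q = points_sub[OF p]
  have "g0 (snd p) (\<lambda>_. 0) (differential M L snd p v) = 0"
    by (rule riemannian_metric_zero[OF L g0 q(2) differential_space_tangent[OF p v]])
  then show ?thesis
    by (simp add: rigged_metric_def pullback_def[where F = id] grw_metric_eq
        dfun_time_inclusion[OF p v] differential_space_inclusion[OF p v] grw_dt_projections[OF I L q])
      (simp add: power2_eq_square algebra_simps)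
qed

text \<open>The metric induced on a null hypersurface is positive semidefinite. If \<open>u \<noteq> 0\<close> is tangent and
  orthogonal to all tangent vectors, then \<open>dt(u) dt(v) = f\<^sup>2 g\<^sub>0(u, v)\<close> for all tangent \<open>v\<close>. Here
  \<open>dt(u) \<noteq> 0\<close>, as otherwise the space component of \<open>u\<close> vanishes too, and Cauchy-Schwarz for \<open>g\<^sub>0\<close>
  gives \<open>dt(u)\<^sup>2 dt(v)\<^sup>2 \<le> dt(u)\<^sup>2 f\<^sup>2 g\<^sub>0(v, v)\<close>.\<close>
lemma null_hypersurface_time_le_space:
  assumes f: "\<forall>t\<in>I. f t > 0"
    and null: "null_hypersurface M (grw_manifold I L) (grw_metric I f L g0)"
    and p: "p \<in> points M" and v: "v \<in> tangent_space M p"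
  shows "(dfun M fst p v)\<^sup>2 \<le>
     (f (fst p))\<^sup>2 * g0 (snd p) (differential M L snd p v) (differential M L snd p v)"
proof -
  note q = points_sub[OF p]
  let ?\<tau> = "dfun M fst p" and ?A = "differential M L snd p" and ?g = "g0 (snd p)" and ?F = "(f (fst p))\<^sup>2"
  have F: "?F > 0" using bspec[OF f q(1)] by simp
  note T = differential_space_tangent[OF p]
  obtain u where u: "u \<in> tangent_space M p" and u0: "u \<noteq> (\<lambda>_. 0)"
    and orth: "\<forall>w\<in>tangent_space M p. pullback M (grw_manifold I L) id (grw_metric I f L g0) p u w = 0"
    using null p unfolding null_hypersurface_def by blast
  have prod: "?\<tau> u * ?\<tau> w = ?F * ?g (?A u) (?A w)" if w: "w \<in> tangent_space M p" for w
    using bspec[OF orth w]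
    by (simp add: pullback_def[where F = id] grw_metric_eq
        dfun_time_inclusion[OF p u] differential_space_inclusion[OF p u]
        dfun_time_inclusion[OF p w] differential_space_inclusion[OF p w])
  have "?\<tau> u \<noteq> 0"
  proof
    assume 0: "?\<tau> u = 0"
    then have "?g (?A u) (?A u) = 0" using prod[OF u] F by simp
    then have "?A u = (\<lambda>_. 0)"
      using riemannian_metric_pos[OF g0 q(2) T[OF u] T[OF u] T[OF u]] by fastforce
    from inclusion_differential_zero[OF p u 0 this] u0 show False by simp
  qed
  then have pos: "(?\<tau> u)\<^sup>2 > 0" by simp
  have "(?\<tau> u)\<^sup>2 * (?\<tau> v)\<^sup>2 = ?F\<^sup>2 * (?g (?A u) (?A v))\<^sup>2"
    using arg_cong[OF prod[OF v], of "\<lambda>r. r\<^sup>2"] by (simp only: power_mult_distrib)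
  also have "\<dots> \<le> ?F\<^sup>2 * (?g (?A u) (?A u) * ?g (?A v) (?A v))"
    by (intro mult_left_mono riemannian_metric_Cauchy_Schwarz[OF L g0 q(2) T[OF u] T[OF v]]) simp
  also have "\<dots> = (?F * ?g (?A u) (?A u)) * (?F * ?g (?A v) (?A v))"
    by (simp only: power2_eq_square[of ?F] ac_simps)
  also have "?F * ?g (?A u) (?A u) = (?\<tau> u)\<^sup>2"
    using prod[OF u] by (simp add: power2_eq_square)
  finally show ?thesis using pos by (simp only: mult_le_cancel_left_pos)
qed

lemma continuous_energy_rigged_metric:
  assumes f: "continuous_on I f"
  shows "continuous_energy M (rigged_metric M (grw_manifold I L) (grw_metric I f L g0)
      (\<lambda>p c. f (fst p) *\<^sub>R grw_dt I L p c))"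
    (is "continuous_energy M ?g")
  unfolding continuous_energy_def
proof (intro ballI conjI)
  fix c assume c: "c \<in> atlas M"
  note M = smooth_manifold_sub
  define R where "R e = map_prod id (snd e) \<circ> chart_inv c" for e :: "('a, 'e) chart"
  define R' where "R' e z = frechet_derivative (R e) (at z)" for e z
  define S where "S e = snd c ` {p \<in> fst c. snd p \<in> fst e}" for e :: "('a, 'e) chart"
  have S: "\<exists>e\<in>atlas L. z \<in> S e" if z: "z \<in> snd c ` fst c" for z
  proof -
    from z obtain p where p: "p \<in> fst c" "z = snd c p" by blast
    then have "c \<in> charts_at M p" using c by (simp add: charts_at_def)
    from ex_space_chart[OF this] obtain e where "e \<in> charts_at L (snd p)" .
    then show ?thesis using p by (intro bexI[of _ e]) (auto simp: S_def charts_at_def)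
  qed
  \<comment> \<open>Around a point whose fibre part lies in the domain of \<open>e\<close>, the energy is expressed through
    the inclusion \<open>R e\<close> in coordinates and its derivative \<open>R' e\<close>.\<close>
  have local: "chart_energy M ?g c z x =
      (f (fst (R e z)))\<^sup>2 * chart_energy L g0 e (snd (R e z)) (snd (R' e z x)) +
      ((f (fst (R e z)))\<^sup>2 - 1) * (fst (R' e z x))\<^sup>2"
    and R'0: "R' e z 0 = 0"
    and RV: "fst (R e z) \<in> I" "snd (R e z) \<in> snd e ` fst e"
    if e: "e \<in> atlas L" and z: "z \<in> S e" for e z x
  proof -
    obtain p where p: "p \<in> fst c" "snd p \<in> fst e" "z = snd c p" using z unfolding S_def by blast
    have cp: "c \<in> charts_at M p" and ep: "e \<in> charts_at L (snd p)"
      using c e p by (simp_all add: charts_at_def)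
    note pM = points_subI[OF cp]
    have inv: "chart_inv c z = p" using chart_inv_chart[OF M c p(1)] p(3) by simp
    have Rz: "R e z = (fst p, snd e (snd p))" by (cases p) (simp add: R_def inv)
    then show "fst (R e z) \<in> I" "snd (R e z) \<in> snd e ` fst e"
      using points_sub(1)[OF pM] p(2) by simp_all
    show "R' e z 0 = 0"
      unfolding R'_def R_def p(3)
      by (rule linear_0[OF has_derivative_linear[OF local_rep_has_derivative[OF cp ep]]])
    note v = coord_vec_in_tangent_space[OF M cp, of x]
    have 1: "dfun M fst p (coord_vec M c p x) = fst (R' e z x)"
      using dfun_time_eq[OF v cp ep] by (simp add: coord_vec_same[OF M cp] R'_def R_def p(3))
    have 2: "differential M L snd p (coord_vec M c p x) = coord_vec L e (snd p) (snd (R' e z x))"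
      using differential_space_eq[OF v cp ep] by (simp add: coord_vec_same[OF M cp] R'_def R_def p(3))
    have "chart_energy M ?g c z x = ?g p (coord_vec M c p x) (coord_vec M c p x)"
      by (simp only: chart_energy_def Let_def inv)
    also have "\<dots> = (f (fst p))\<^sup>2 * g0 (snd p) (coord_vec L e (snd p) (snd (R' e z x)))
          (coord_vec L e (snd p) (snd (R' e z x))) + ((f (fst p))\<^sup>2 - 1) * (fst (R' e z x))\<^sup>2"
      by (simp only: rigged_metric_eq[OF pM v] 1 2)
    finally show "chart_energy M ?g c z x =
      (f (fst (R e z)))\<^sup>2 * chart_energy L g0 e (snd (R e z)) (snd (R' e z x)) +
      ((f (fst (R e z)))\<^sup>2 - 1) * (fst (R' e z x))\<^sup>2"
      by (simp only: chart_energy_def Let_def Rz fst_conv snd_conv chart_inv_chart[OF L e p(2)])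
  qed
  note energy = continuous_energy_riemannian[OF L g0, unfolded continuous_energy_def]
  show "chart_energy M ?g c z 0 = 0" if z: "z \<in> snd c ` fst c" for z
  proof -
    obtain e where e: "e \<in> atlas L" "z \<in> S e" using S[OF z] by (rule bexE)
    have "chart_energy L g0 e (snd (R e z)) 0 = 0"
      using energy e(1) RV(2)[OF e] by blast
    then show ?thesis by (simp add: local[OF e] R'0[OF e])
  qed
  have cont: "continuous_on (S e \<times> UNIV) (\<lambda>(z, x). chart_energy M ?g c z x)" if e: "e \<in> atlas L" for e
  proof -
    have sm: "smooth_on (S e) (R e)"
      unfolding S_def R_def by (rule smooth_on_local_rep[OF c e])
    have R: "continuous_on (S e \<times> UNIV) (\<lambda>q. R e (fst q))"
      by (rule continuous_on_compose2[OF smooth_on_continuous_on[OF sm]]) (auto intro!: continuous_intros)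
    have R': "continuous_on (S e \<times> UNIV) (\<lambda>q. R' e (fst q) (snd q))"
      using continuous_on_derivative_pair[OF sm] by (simp add: R'_def case_prod_unfold)
    have fR: "continuous_on (S e \<times> UNIV) (\<lambda>q. f (fst (R e (fst q))))"
      by (rule continuous_on_compose2[OF f continuous_on_fst[OF R]]) (use RV(1)[OF e] in auto)
    have "continuous_on ((snd e ` fst e) \<times> UNIV) (\<lambda>(y, x). chart_energy L g0 e y x)"
      using energy e by blast
    then have "continuous_on (S e \<times> UNIV)
       (\<lambda>q. (\<lambda>(y, x). chart_energy L g0 e y x) (snd (R e (fst q)), snd (R' e (fst q) (snd q))))"
      by (rule continuous_on_compose2[OF _ continuous_on_Pair[OF continuous_on_snd[OF R] continuous_on_snd[OF R']]])
        (use RV(2)[OF e] in auto)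
    then have "continuous_on (S e \<times> UNIV)
       (\<lambda>q. (f (fst (R e (fst q))))\<^sup>2 *
          chart_energy L g0 e (snd (R e (fst q))) (snd (R' e (fst q) (snd q))) +
          ((f (fst (R e (fst q))))\<^sup>2 - 1) * (fst (R' e (fst q) (snd q)))\<^sup>2)"
      by (intro continuous_on_add continuous_on_mult continuous_on_power continuous_on_diff
          continuous_on_const fR continuous_on_fst[OF R']) simp
    then show ?thesis
      by (rule continuous_on_eq) (use local[OF e] in auto)
  qed
  show "continuous_on (snd c ` fst c \<times> UNIV) (\<lambda>(z, x). chart_energy M ?g c z x)"
  proof (intro continuous_at_imp_continuous_on ballI)
    fix q :: "'m \<times> 'm" assume "q \<in> snd c ` fst c \<times> UNIV"
    then have "fst q \<in> snd c ` fst c" by (simp add: mem_Times_iff)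
    from S[OF this] obtain e where e: "e \<in> atlas L" "fst q \<in> S e" by (rule bexE)
    have op: "open (S e \<times> (UNIV :: 'm set))"
      unfolding S_def by (rule open_Times[OF open_local_rep_domain[OF c e(1)] open_UNIV])
    have "q \<in> S e \<times> UNIV" using e(2) by (simp add: mem_Times_iff)
    with iffD1[OF continuous_on_eq_continuous_at[OF op] cont[OF e(1)]]
    show "isCont (\<lambda>(z, x). chart_energy M ?g c z x) q" by (rule bspec)
  qed
qed

lemma time_function_has_derivative:
  assumes h: "\<forall>t\<in>I. (h has_real_derivative - f t) (at t)"
    and c: "c \<in> charts_at M p" and e: "e \<in> charts_at L (snd p)"
  shows "((\<lambda>q. h (fst q)) \<circ> chart_inv c has_derivative
     (\<lambda>x. - f (fst p) * fst (frechet_derivative (map_prod id (snd e) \<circ> chart_inv c) (at (snd c p)) x)))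
     (at (snd c p))"
proof -
  have "(h has_derivative (*) (- f (fst p))) (at ((fst \<circ> chart_inv c) (snd c p)))"
    using h points_sub(1)[OF points_subI[OF c]] chart_inv_chart[OF smooth_manifold_sub charts_atD[OF c]]
    by (simp add: has_field_derivative_def)
  from has_derivative_compose[OF time_has_derivative[OF c e] this] show ?thesis
    by (simp add: o_def)
qed

lemma dfun_time_function:
  assumes h: "\<forall>t\<in>I. (h has_real_derivative - f t) (at t)"
    and p: "p \<in> points M" and v: "v \<in> tangent_space M p"
  shows "dfun M (\<lambda>q. h (fst q)) p v = - f (fst p) * dfun M fst p v"
proof -
  obtain c where c: "c \<in> charts_at M p" using ex_chart[OF smooth_manifold_sub p] ..
  obtain e where e: "e \<in> charts_at L (snd p)" using ex_space_chart[OF c] .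
  have "dfun M (\<lambda>q. h (fst q)) p v =
      frechet_derivative ((\<lambda>q. h (fst q)) \<circ> chart_inv c) (at (snd c p)) (v c)"
    using time_function_has_derivative[OF h _ e]
    by (intro dfun_eq[OF smooth_manifold_sub c v]) (rule differentiableI)
  then show ?thesis
    using fun_cong[OF frechet_derivative_at[OF time_function_has_derivative[OF h c e]], of "v c"]
    by (simp add: dfun_time_eq[OF v c e])
qed

end


section \<open>Completeness of the rigged metric\<close>

theorem proposition4p4:
  fixes I :: "real set" and f h :: "real \<Rightarrow> real"
    and L :: "('a, 'e::euclidean_space) manifold" and g0 :: "('a, 'e) tensor2"
    and M :: "(real \<times> 'a, 'm::euclidean_space) manifold"
    and \<zeta> :: "real \<times> 'a \<Rightarrow> (real \<times> 'a, real \<times> 'e) tvec"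
  assumes "open I" and "is_interval I" and "I \<noteq> {}"
    and "smooth_on I f" and "\<forall>t\<in>I. f t > 0"
    and "smooth_manifold L" and "riemannian_metric L g0"
    and "\<forall>t\<in>I. (h has_real_derivative - f t) (at t)"
    and "null_hypersurface M (grw_manifold I L) (grw_metric I f L g0)"
    and "\<zeta> = (\<lambda>p c. f (fst p) *\<^sub>R grw_dt I L p c)"
    and "rigging M (grw_manifold I L) \<zeta>"
    and "proper_map (mtop M) euclideanreal ((\<lambda>(t, x). h t) \<circ> id)"
  shows "riemannian_complete M (rigged_metric M (grw_manifold I L) (grw_metric I f L g0) \<zeta>)"
proof -
  have sub: "submanifold M (grw_manifold I L)"
    using assms(9) unfolding null_hypersurface_def hypersurface_def by blast
  note ctx = assms(1,6,7) sub
  show ?thesis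
    unfolding assms(10)
  proof (rule riemannian_complete_if_proper[where \<phi> = "\<lambda>q. h (fst q)"])
    show "smooth_manifold M" by (rule smooth_manifold_sub[OF ctx])
    show "continuous_energy M (rigged_metric M (grw_manifold I L) (grw_metric I f L g0)
        (\<lambda>p c. f (fst p) *\<^sub>R grw_dt I L p c))"
      by (rule continuous_energy_rigged_metric[OF ctx smooth_on_continuous_on[OF assms(4)]])
    fix p c assume c: "c \<in> charts_at M p"
    obtain e where e: "e \<in> charts_at L (snd p)" using ex_space_chart[OF ctx c] .
    show "(\<lambda>q. h (fst q)) \<circ> chart_inv c differentiable at (snd c p)"
      by (rule differentiableI[OF time_function_has_derivative[OF ctx assms(8) c e]])
  next
    fix p v assume p: "p \<in> points M" and v: "v \<in> tangent_space M p"
    show "(dfun M (\<lambda>q. h (fst q)) p v)\<^sup>2 \<le> rigged_metric M (grw_manifold I L) (grw_metric I f L g0)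
        (\<lambda>p c. f (fst p) *\<^sub>R grw_dt I L p c) p v v"
      using null_hypersurface_time_le_space[OF ctx assms(5,9) p v]
      by (simp add: rigged_metric_eq[OF ctx p v] dfun_time_function[OF ctx assms(8) p v] algebra_simps)
  next
    have "((\<lambda>(t, x). h t) \<circ> id) = (\<lambda>q::real \<times> 'a. h (fst q))" by (auto simp: case_prod_unfold)
    with assms(12) show "proper_map (mtop M) euclideanreal (\<lambda>q. h (fst q))" by simp
  qed
qed

end
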